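(* Let $c\in\{0,N\}$. A zero-mean Gaussian sequence $[x_k]=(x_0,\dots,x_N)$ of $\mathbb{R}^d$-valued vectors is $CM_c$ if and only if it can be represented as $$x_k=y_k+\Gamma_k x_c,\qquad k\in[0,N]\setminus\{c\},$$ where $[y_k]\setminus\{y_c\}$ is a zero-mean Gaussian Markov sequence, $x_c$ is a zero-mean Gaussian vector uncorrelated with $[y_k]\setminus\{y_c\}$, and $\Gamma_k$ are some ($d\times d$) matrices.
   Context: Sequences are indexed by discrete time $[0,N]=(0,1,\dots,N)$; $[x_k]_i^j=(x_i,\dots,x_j)$. $[y_k]\setminus\{y_c\}$ means $[y_k]_0^{N-1}$ for $c=N$ and $[y_k]_1^N$ for $c=0$. Gaussian sequences are jointly Gaussian, with possibly singular covariance. Equations between random vectors hold almost surely. $F(\cdot|\cdot)$ denotes conditional CDF. A sequence $[y_k]_a^b$ is Markov iff $F(\xi_k|[y_i]_a^j)=F(\xi_k|y_j)$ (a.s.) for all $a\le j<k\le b$ and all $\xi_k\in\mathbb{R}^d$. $[x_k]$ is $CM_c$ iff conditioned on $x_c$ the sequence is Markov over $[1,N]$ (if $c=0$) or over $[0,N-1]$ (if $c=N$); equivalently, $F(\xi_k|[x_i]_0^j,x_c)=F(\xi_k|x_j,x_c)$ (a.s.) for all $j<k$ in $[0,N]$ and all $\xi_k\in\mathbb{R}^d$. *)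

theory Defs
  imports "HOL-Probability.Probability"
begin

text \<open>
  Random vectors are functions into \<^typ>\<open>real ^ 'd\<close> on a probability space \<open>M\<close>; a (finite) sequence
  of them is a function on \<^typ>\<open>nat\<close> that is only inspected on an index set \<open>I\<close>.
\<close>

text \<open>Univariate normal law; \<open>\<sigma> = 0\<close> is the degenerate (almost surely constant) case.\<close>

definition normal_rv :: "'a measure \<Rightarrow> ('a \<Rightarrow> real) \<Rightarrow> bool" where
  "normal_rv M Z \<longleftrightarrow> Z \<in> borel_measurable M \<and>
     (\<exists>\<mu> \<sigma>. (\<sigma> = 0 \<and> (AE \<omega> in M. Z \<omega> = \<mu>)) \<or>
            (\<sigma> > 0 \<and> distributed M lborel Z (normal_density \<mu> \<sigma>)))"

text \<open>
  Joint Gaussianity, covariance possibly singular: every linear combination of all the components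
  of all the \<open>x k\<close>, \<open>k \<in> I\<close>, is normal in the above sense.
\<close>

definition gaussian_seq :: "'a measure \<Rightarrow> nat set \<Rightarrow> (nat \<Rightarrow> 'a \<Rightarrow> real ^ 'd) \<Rightarrow> bool" where
  "gaussian_seq M I x \<longleftrightarrow>
     (\<forall>k\<in>I. x k \<in> borel_measurable M) \<and>
     (\<forall>a :: nat \<Rightarrow> real ^ 'd. normal_rv M (\<lambda>\<omega>. \<Sum>k\<in>I. a k \<bullet> x k \<omega>))"

definition zero_mean_seq :: "'a measure \<Rightarrow> nat set \<Rightarrow> (nat \<Rightarrow> 'a \<Rightarrow> real ^ 'd) \<Rightarrow> bool" where
  "zero_mean_seq M I x \<longleftrightarrow> (\<forall>k\<in>I. integrable M (x k) \<and> integral\<^sup>L M (x k) = 0)"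

definition cross_cov :: "'a measure \<Rightarrow> ('a \<Rightarrow> real ^ 'd) \<Rightarrow> ('a \<Rightarrow> real ^ 'e) \<Rightarrow> real ^ 'e ^ 'd" where
  "cross_cov M X Y = (\<chi> i j. integral\<^sup>L M (\<lambda>\<omega>.
     (X \<omega> $ i - integral\<^sup>L M (\<lambda>\<omega>. X \<omega> $ i)) * (Y \<omega> $ j - integral\<^sup>L M (\<lambda>\<omega>. Y \<omega> $ j))))"

definition uncorrelated :: "'a measure \<Rightarrow> ('a \<Rightarrow> real ^ 'd) \<Rightarrow> ('a \<Rightarrow> real ^ 'e) \<Rightarrow> bool" where
  "uncorrelated M X Y \<longleftrightarrow> cross_cov M X Y = 0"

text \<open>The \<open>\<sigma>\<close>-algebra on \<open>\<Omega>\<close> generated by the family \<open>(x i)\<^sub>i\<close>, \<open>i \<in> J\<close>.\<close>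

definition generated_by :: "'a measure \<Rightarrow> nat set \<Rightarrow> (nat \<Rightarrow> 'a \<Rightarrow> real ^ 'd) \<Rightarrow> 'a measure" where
  "generated_by M J x =
     vimage_algebra (space M) (\<lambda>\<omega>. \<lambda>i\<in>J. x i \<omega>) (\<Pi>\<^sub>M i\<in>J. borel)"

text \<open>
  The conditional CDF \<open>F(\<xi>\<^sub>k | x\<^sub>i, i \<in> J)\<close> of \<open>x k\<close>, as a random variable on \<open>\<Omega>\<close> determined up to
  almost sure equality: the conditional probability of the event that \<open>x k\<close> is componentwise
  at most \<open>\<xi>\<close>.
\<close>

definition cond_cdf ::
    "'a measure \<Rightarrow> (nat \<Rightarrow> 'a \<Rightarrow> real ^ 'd) \<Rightarrow> nat \<Rightarrow> nat set \<Rightarrow> real ^ 'd \<Rightarrow> 'a \<Rightarrow> real" where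
  "cond_cdf M x k J \<xi> =
     real_cond_exp M (generated_by M J x) (indicator {\<omega> \<in> space M. \<forall>i. x k \<omega> $ i \<le> \<xi> $ i})"

text \<open>For \<open>I = {a..b}\<close> the conditioning set \<open>{i \<in> I. i \<le> j}\<close> is \<open>{a..j}\<close>.\<close>

definition markov_seq :: "'a measure \<Rightarrow> nat set \<Rightarrow> (nat \<Rightarrow> 'a \<Rightarrow> real ^ 'd) \<Rightarrow> bool" where
  "markov_seq M I y \<longleftrightarrow>
     (\<forall>j\<in>I. \<forall>k\<in>I. j < k \<longrightarrow> (\<forall>\<xi>.
        AE \<omega> in M. cond_cdf M y k {i \<in> I. i \<le> j} \<xi> \<omega> = cond_cdf M y k {j} \<xi> \<omega>))"

definition CM_seq :: "'a measure \<Rightarrow> nat \<Rightarrow> nat \<Rightarrow> (nat \<Rightarrow> 'a \<Rightarrow> real ^ 'd) \<Rightarrow> bool" where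
  "CM_seq M N c x \<longleftrightarrow>
     (\<forall>j\<in>{0..N}. \<forall>k\<in>{0..N}. j < k \<longrightarrow> (\<forall>\<xi>.
        AE \<omega> in M. cond_cdf M x k ({0..j} \<union> {c}) \<xi> \<omega> = cond_cdf M x k {j, c} \<xi> \<omega>))"

end

theory Submission
  imports Defs
begin

text \<open>
  For a zero-mean Gaussian family, the conditional laws of \<open>x k\<close> given \<open>(x i)\<close>, \<open>i \<in> J'\<close>, and given
  \<open>(x i)\<close>, \<open>i \<in> J \<subseteq> J'\<close>, agree iff every component of \<open>x k\<close> differs from a linear combination of
  \<open>(x i)\<close>, \<open>i \<in> J\<close>, by a residual uncorrelated with all \<open>x i\<close>, \<open>i \<in> J'\<close>. So both \<open>CM\<^sub>c\<close> and the Markov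
  property are statements about covariances, and for \<open>y\<^sub>k = x\<^sub>k - \<Gamma>\<^sub>k x\<^sub>c\<close> uncorrelated with \<open>x\<^sub>c\<close>
  they translate into each other by linear algebra. Possibly singular covariances rule out densities;
  independence of uncorrelated variables is obtained from one-dimensional characteristic functions,
  one coordinate at a time: an integrable \<open>f\<close> with \<open>E[cos (\<theta> + t \<bullet> U) f] = 0\<close> for all \<open>\<theta>\<close> and \<open>t\<close> has
  conditional expectation \<open>0\<close> given \<open>U\<close>.
\<close>

section \<open>Trigonometric test functions\<close>

text \<open>Conditional CDFs are given event by event, each equation up to its own null set, and no
  regular conditional law is constructed. Duality takes its place: fix \<open>G\<close> in the
  larger sigma-algebra F' and put u = 1_G - P(G | F). Equality of all conditional CDFs given F' and
  F then says that the signed measure A -> E[1_A(x k) u] vanishes on lower orthants, hence on all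
  Borel sets. From CDFs to covariances, one integrates the coordinates against this measure and
  obtains equal conditional means, of which the one given F is linear. From covariances to CDFs, one
  computes its Fourier transform after splitting \<open>x k\<close> into a prediction and an
  independent residual. Cosines with a free phase \<theta> replace complex exponentials: the phase
  -pi/2 gives the sine, all integrals stay real, and 2 cos a cos b = cos (a + b) + cos (a - b) keeps
  products inside the class. The matrix \<open>\<Gamma> k\<close> is a regression of
  \<open>x k\<close> on \<open>x c\<close>. Subtracting it preserves Gaussianity, and a single
  equivalence between the two Markov properties serves both directions of the theorem.\<close>

lemma integral_indicator_generator_eq_0:
  fixes f :: "'a \<Rightarrow> real"
  assumes U[measurable]: "U \<in> measurable M N" and f: "integrable M f" "integral\<^sup>L M f = 0"
    and G: "Int_stable G" "G \<subseteq> Pow (space N)" "sets N = sigma_sets (space N) G"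
    and zero: "\<And>A. A \<in> G \<Longrightarrow> (\<integral>\<omega>. indicator A (U \<omega>) * f \<omega> \<partial>M) = 0"
    and A: "A \<in> sets N"
  shows "(\<integral>\<omega>. indicator A (U \<omega>) * f \<omega> \<partial>M) = 0"
proof -
  have int: "integrable M (\<lambda>\<omega>. indicator B (U \<omega>) * f \<omega>)" if [measurable]: "B \<in> sets N" for B
    using f(1) by (rule Bochner_Integration.integrable_bound) (use f(1) in \<open>auto split: split_indicator\<close>)
  have "A \<in> sigma_sets (space N) G" using A G(3) by simp
  with G(1,2) show ?thesis
  \<comment> \<open>Dynkin's pi-lambda argument for a signed density: complements are covered
    because \<open>f\<close> has integral 0, disjoint unions by countable additivity of the
    integral.\<close>
  proof (induction rule: sigma_sets_induct_disjoint)
    case (basic A)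
    then show ?case by (rule zero)
  next
    case empty
    then show ?case by simp
  next
    case (compl A)
    then have A: "A \<in> sets N" by (simp add: G)
    have "(\<integral>\<omega>. indicator (space N - A) (U \<omega>) * f \<omega> \<partial>M) = (\<integral>\<omega>. f \<omega> - indicator A (U \<omega>) * f \<omega> \<partial>M)"
      using measurable_space[OF U] by (intro Bochner_Integration.integral_cong) (auto split: split_indicator)
    also have "\<dots> = 0" using int[OF A] f compl by simp
    finally show ?case .
  next
    case (union A)
    then have A[measurable]: "\<And>i. A i \<in> sets N" by (auto simp: G)
    define B where "B = (\<lambda>i. U -` A i \<inter> space M)"
    have B[measurable]: "B i \<in> sets M" for i unfolding B_def by measurable
    have "(\<integral>\<omega>. indicator (\<Union>i. A i) (U \<omega>) * f \<omega> \<partial>M) = (LINT \<omega>:(\<Union>i. B i)|M. f \<omega>)"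
      unfolding set_lebesgue_integral_def B_def
      by (intro Bochner_Integration.integral_cong) (auto split: split_indicator)
    also have "\<dots> = (\<Sum>i. LINT \<omega>:B i|M. f \<omega>)"
    proof (rule lebesgue_integral_countable_add)
      show "set_integrable M (\<Union>i. B i) f"
        unfolding set_integrable_def by (rule integrable_mult_indicator) (use f in auto)
      show "\<And>i j. i \<noteq> j \<Longrightarrow> B i \<inter> B j = {}"
        using union(1) by (auto simp: B_def disjoint_family_on_def)
    qed simp
    also have "(\<lambda>i. LINT \<omega>:B i|M. f \<omega>) = (\<lambda>i. \<integral>\<omega>. indicator (A i) (U \<omega>) * f \<omega> \<partial>M)"
      unfolding set_lebesgue_integral_def B_def
      by (intro ext Bochner_Integration.integral_cong) (auto split: split_indicator)
    finally show ?case using union by simp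
  qed
qed

lemma integrable_cos_mult:
  fixes f V :: "'a \<Rightarrow> real"
  assumes "V \<in> borel_measurable M" "integrable M f"
  shows "integrable M (\<lambda>\<omega>. cos (V \<omega>) * f \<omega>)"
  using assms(2) by (rule Bochner_Integration.integrable_bound)
    (use assms in \<open>auto simp: abs_mult intro!: AE_I2 mult_left_le_one_le\<close>)

lemma integrable_indicator_mult:
  fixes f :: "'a \<Rightarrow> real"
  assumes "U \<in> measurable M N" "A \<in> sets N" "integrable M f"
  shows "integrable M (\<lambda>\<omega>. indicator A (U \<omega>) * f \<omega>)"
  using assms(3) by (rule Bochner_Integration.integrable_bound)
    (use assms in \<open>auto split: split_indicator\<close>)

text \<open>The order is componentwise, so two lower orthants meet in the orthant below the infimum
  of their corners. These orthants are the events in \<open>cond_cdf\<close>, and being a generator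
  closed under intersection they decide about all Borel events.\<close>

lemma Int_stable_atMost_vec: "Int_stable (range (\<lambda>a :: real ^ 'n. {..a}))"
proof (rule Int_stableI)
  fix S T assume "S \<in> range (\<lambda>a :: real ^ 'n. {..a})" "T \<in> range (\<lambda>a :: real ^ 'n. {..a})"
  then obtain a b where "S = {..a}" "T = {..b}" by auto
  then have "S \<inter> T = {..inf a b}" by auto
  then show "S \<inter> T \<in> range (\<lambda>a :: real ^ 'n. {..a})" by simp
qed

context prob_space
begin

text \<open>The normalised positive and negative parts of \<open>f\<close> push forward along \<open>U\<close> to laws on the real
  line with the same characteristic function.\<close>

lemma integral_indicator_eq_0_if_cos_real:
  fixes f U :: "'a \<Rightarrow> real"
  assumes U[measurable]: "U \<in> borel_measurable M" and f: "integrable M f"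
    and cos: "\<And>\<theta> t. (\<integral>\<omega>. cos (\<theta> + t * U \<omega>) * f \<omega> \<partial>M) = 0"
    and A[measurable]: "A \<in> sets borel"
  shows "(\<integral>\<omega>. indicator A (U \<omega>) * f \<omega> \<partial>M) = 0"
proof -
  have [measurable]: "f \<in> borel_measurable M" using f by auto
  \<comment> \<open>Both parts of \<open>f\<close> have the same mass \<open>m\<close>, because
    \<theta> = t = 0 in \<open>cos\<close> says that \<open>f\<close> has integral 0. Division by
    \<open>m\<close> turns them into probability densities.\<close>
  define m where "m = (\<integral>\<omega>. max 0 (f \<omega>) \<partial>M)"
  have int[simp]: "integrable M (\<lambda>\<omega>. max 0 (f \<omega>))" "integrable M (\<lambda>\<omega>. max 0 (- f \<omega>))"
    using f by auto
  have split: "max 0 (f \<omega>) - max 0 (- f \<omega>) = f \<omega>" for \<omega> by auto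
  have "(\<integral>\<omega>. max 0 (f \<omega>) \<partial>M) - (\<integral>\<omega>. max 0 (- f \<omega>) \<partial>M) = (\<integral>\<omega>. f \<omega> \<partial>M)"
    by (subst Bochner_Integration.integral_diff[symmetric]) (simp_all only: split int)
  then have m': "(\<integral>\<omega>. max 0 (- f \<omega>) \<partial>M) = m" using cos[of 0 0] by (simp add: m_def)
  have eq_of: "(\<integral>\<omega>. g \<omega> * (max 0 (f \<omega>) / m) \<partial>M) = (\<integral>\<omega>. g \<omega> * (max 0 (- f \<omega>) / m) \<partial>M)
      \<longleftrightarrow> (\<integral>\<omega>. g \<omega> * f \<omega> \<partial>M) = 0"
    if "m \<noteq> 0" "g \<in> borel_measurable M" "\<And>\<omega>. \<bar>g \<omega>\<bar> \<le> 1" for g :: "'a \<Rightarrow> real"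
  proof -
    have b: "integrable M (\<lambda>\<omega>. g \<omega> * h \<omega>)" if "integrable M h" for h :: "'a \<Rightarrow> real"
      using that by (rule Bochner_Integration.integrable_bound)
        (use that \<open>g \<in> _\<close> \<open>\<And>\<omega>. \<bar>g \<omega>\<bar> \<le> 1\<close> in \<open>auto simp: abs_mult intro!: AE_I2 mult_left_le_one_le\<close>)
    have "(\<integral>\<omega>. g \<omega> * f \<omega> \<partial>M) = (\<integral>\<omega>. g \<omega> * max 0 (f \<omega>) - g \<omega> * max 0 (- f \<omega>) \<partial>M)"
      by (simp only: split flip: right_diff_distrib)
    also have "\<dots> = (\<integral>\<omega>. g \<omega> * max 0 (f \<omega>) \<partial>M) - (\<integral>\<omega>. g \<omega> * max 0 (- f \<omega>) \<partial>M)"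
      using b int by simp
    finally show ?thesis using \<open>m \<noteq> 0\<close> by simp
  qed
  show ?thesis
  proof (cases "m = 0")
    \<comment> \<open>Mass 0 cannot be normalised, but then \<open>f\<close> is almost surely
      0.\<close>
    case True
    then have "AE \<omega> in M. max 0 (f \<omega>) = 0" "AE \<omega> in M. max 0 (- f \<omega>) = 0"
      using m' integral_nonneg_eq_0_iff_AE[OF int(1)] integral_nonneg_eq_0_iff_AE[OF int(2)]
      by (simp_all add: m_def)
    then have "AE \<omega> in M. indicator A (U \<omega>) * f \<omega> = 0" by eventually_elim auto
    then show ?thesis by (rule integral_eq_zero_AE)
  next
    case False
    have "m \<ge> 0" unfolding m_def by simp
    with False have m: "m > 0" by simp
    have real_distr: "real_distribution (distr (density M (\<lambda>\<omega>. ennreal (h \<omega> / m))) borel U)"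
      if h: "\<And>\<omega>. h \<omega> \<ge> 0" "integrable M h" "(\<integral>\<omega>. h \<omega> \<partial>M) = m" for h
    proof -
      have [measurable]: "h \<in> borel_measurable M" using h by auto
      have "prob_space (density M (\<lambda>\<omega>. ennreal (h \<omega> / m)))"
      proof
        have "(\<integral>\<^sup>+\<omega>. ennreal (h \<omega> / m) \<partial>M) = ennreal (\<integral>\<omega>. h \<omega> / m \<partial>M)"
          using h m by (intro nn_integral_eq_integral) auto
        then show "emeasure (density M (\<lambda>\<omega>. ennreal (h \<omega> / m))) (space (density M (\<lambda>\<omega>. ennreal (h \<omega> / m)))) = 1"
          using h m by (simp add: emeasure_density cong: nn_integral_cong)
      qed
      then interpret D: prob_space "density M (\<lambda>\<omega>. ennreal (h \<omega> / m))" .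
      show ?thesis by (intro D.real_distribution_distr) simp
    qed
    define P where "P = distr (density M (\<lambda>\<omega>. ennreal (max 0 (f \<omega>) / m))) borel U"
    define Q where "Q = distr (density M (\<lambda>\<omega>. ennreal (max 0 (- f \<omega>) / m))) borel U"
    interpret P: real_distribution P unfolding P_def by (rule real_distr) (simp_all add: m_def)
    interpret Q: real_distribution Q unfolding Q_def by (rule real_distr) (simp_all add: m')
    have intP: "(\<integral>u. g u \<partial>P) = (\<integral>\<omega>. g (U \<omega>) * (max 0 (f \<omega>) / m) \<partial>M)"
      and intQ: "(\<integral>u. g u \<partial>Q) = (\<integral>\<omega>. g (U \<omega>) * (max 0 (- f \<omega>) / m) \<partial>M)"
      if [measurable]: "g \<in> borel_measurable borel" for g :: "real \<Rightarrow> real"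
      unfolding P_def Q_def using m
      by (simp_all add: integral_distr integral_real_density mult.commute)
    have "char P = char Q"
    proof
      fix t
      have trig: "(\<integral>u. cos (\<theta> + t * u) \<partial>P) = (\<integral>u. cos (\<theta> + t * u) \<partial>Q)" for \<theta>
        using eq_of[of "\<lambda>\<omega>. cos (\<theta> + t * U \<omega>)"] cos[of \<theta> t] m by (simp add: intP intQ)
      \<comment> \<open>The phase -pi/2 extracts the imaginary part of the characteristic function
        from the same hypothesis on cosines.\<close>
      have sin: "sin x = cos (- (pi / 2) + x)" for x :: real
        using cos_diff[of x "pi / 2"] by simp
      have char: "Re (char R t) = (\<integral>u. cos (0 + t * u) \<partial>R)" "Im (char R t) = (\<integral>u. cos (- (pi / 2) + t * u) \<partial>R)"
        if "real_distribution R" for R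
      proof -
        interpret R: real_distribution R by fact
        have int: "complex_integrable R (\<lambda>u. iexp (t * u))" by (rule R.integrable_iexp) simp_all
        show "Re (char R t) = (\<integral>u. cos (0 + t * u) \<partial>R)"
          unfolding char_def integral_Re[OF int, symmetric] by (simp add: Re_exp)
        show "Im (char R t) = (\<integral>u. cos (- (pi / 2) + t * u) \<partial>R)"
          unfolding char_def integral_Im[OF int, symmetric] sin[symmetric] by (simp add: Im_exp)
      qed
      then show "char P t = char Q t"
        by (intro complex_eqI)
          (simp_all only: char[OF P.real_distribution_axioms] char[OF Q.real_distribution_axioms] trig)
    qed
    then have "P = Q"
      by (intro Levy_uniqueness P.real_distribution_axioms Q.real_distribution_axioms)
    then have "(\<integral>\<omega>. indicator A (U \<omega>) * (max 0 (f \<omega>) / m) \<partial>M)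
        = (\<integral>\<omega>. indicator A (U \<omega>) * (max 0 (- f \<omega>) / m) \<partial>M)"
      using intP[of "indicator A"] intQ[of "indicator A"] by (simp only: borel_measurable_indicator A)
    then show ?thesis
      using eq_of[of "\<lambda>\<omega>. indicator A (U \<omega>)"] m by simp
  qed
qed

text \<open>Indicators are inserted one coordinate at a time, each being absorbed into
  \<open>f\<close>; this is why the induction runs over arbitrary \<open>f\<close> and why
  \<open>single\<close> is assumed for all \<open>f\<close>. The one-coordinate case stays a
  hypothesis because the lemma serves on two levels: for the real coordinates of one vector, and for
  the vectors of a family.\<close>

lemma integral_prod_indicator_eq_0_if_cos:
  fixes U :: "'i \<Rightarrow> 'a \<Rightarrow> 'b::euclidean_space" and f :: "'a \<Rightarrow> real"
  assumes "finite K" and U: "\<And>i. i \<in> K \<Longrightarrow> U i \<in> borel_measurable M"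
    and single: "\<And>i f A. \<lbrakk>i \<in> K; integrable M f;
        \<And>\<theta> t. (\<integral>\<omega>. cos (\<theta> + t \<bullet> U i \<omega>) * f \<omega> \<partial>M) = 0; A \<in> sets borel\<rbrakk>
      \<Longrightarrow> (\<integral>\<omega>. indicator A (U i \<omega>) * f \<omega> \<partial>M) = 0"
    and f: "integrable M f"
    and cos: "\<And>\<theta> t. (\<integral>\<omega>. cos (\<theta> + (\<Sum>i\<in>K. t i \<bullet> U i \<omega>)) * f \<omega> \<partial>M) = 0"
    and A: "\<And>i. i \<in> K \<Longrightarrow> A i \<in> sets borel"
  shows "(\<integral>\<omega>. (\<Prod>i\<in>K. indicator (A i) (U i \<omega>)) * f \<omega> \<partial>M) = 0"
  using assms
proof (induction K arbitrary: f rule: finite_induct)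
  case empty
  then show ?case using empty(4)[of 0] by simp
next
  case (insert p K)
  have Up[measurable]: "U p \<in> borel_measurable M" by (rule insert.prems) simp
  have UK[measurable]: "i \<in> K \<Longrightarrow> U i \<in> borel_measurable M" for i by (rule insert.prems) simp
  have Ap[measurable]: "A p \<in> sets borel" by (rule insert.prems) simp
  have f: "integrable M f" by (rule insert.prems)
  have two: "2 * cos a * cos b = cos (a + b) + cos (a - b)" for a b :: real
    by (simp add: cos_add cos_diff)
  have step: "(\<integral>\<omega>. cos (\<theta> + (\<Sum>i\<in>K. t i \<bullet> U i \<omega>)) * (indicator (A p) (U p \<omega>) * f \<omega>) \<partial>M) = 0" for \<theta> t
  proof -
    define V where "V = (\<lambda>\<omega>. \<theta> + (\<Sum>i\<in>K. t i \<bullet> U i \<omega>))"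
    have [measurable]: "V \<in> borel_measurable M" unfolding V_def by measurable
    \<comment> \<open>Now \<open>cos (V \<omega>) * f \<omega>\<close> plays the role of
      \<open>f\<close>, so that \<open>single\<close> acts on the coordinate \<open>p\<close> alone.
      The product of cosines becomes a sum of two cosines of combinations over
      \<open>insert p K\<close>, with \<open>t\<close> taken once with each sign.\<close>
    have "(\<integral>\<omega>. cos (\<theta>' + s \<bullet> U p \<omega>) * (cos (V \<omega>) * f \<omega>) \<partial>M) = 0" for \<theta>' s
    proof -
      define t1 where "t1 = (\<lambda>i. if i = p then s else t i)"
      define t2 where "t2 = (\<lambda>i. if i = p then s else - t i)"
      have *: "\<theta>' + s \<bullet> U p \<omega> + V \<omega> = \<theta>' + \<theta> + (\<Sum>i\<in>insert p K. t1 i \<bullet> U i \<omega>)"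
          "\<theta>' + s \<bullet> U p \<omega> - V \<omega> = \<theta>' - \<theta> + (\<Sum>i\<in>insert p K. t2 i \<bullet> U i \<omega>)" for \<omega>
      proof -
        have "(\<Sum>i\<in>K. t1 i \<bullet> U i \<omega>) = (\<Sum>i\<in>K. t i \<bullet> U i \<omega>)" "(\<Sum>i\<in>K. t2 i \<bullet> U i \<omega>) = (\<Sum>i\<in>K. - (t i \<bullet> U i \<omega>))"
          using insert.hyps by (auto intro!: sum.cong simp: t1_def t2_def)
        then show "\<theta>' + s \<bullet> U p \<omega> + V \<omega> = \<theta>' + \<theta> + (\<Sum>i\<in>insert p K. t1 i \<bullet> U i \<omega>)"
          "\<theta>' + s \<bullet> U p \<omega> - V \<omega> = \<theta>' - \<theta> + (\<Sum>i\<in>insert p K. t2 i \<bullet> U i \<omega>)"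
          using insert.hyps by (simp_all add: V_def t1_def t2_def sum_negf)
      qed
      have "2 * (\<integral>\<omega>. cos (\<theta>' + s \<bullet> U p \<omega>) * (cos (V \<omega>) * f \<omega>) \<partial>M)
        = (\<integral>\<omega>. cos (\<theta>' + s \<bullet> U p \<omega> + V \<omega>) * f \<omega> + cos (\<theta>' + s \<bullet> U p \<omega> - V \<omega>) * f \<omega> \<partial>M)"
        by (simp only: two[symmetric] mult.assoc flip: distrib_right integral_mult_right_zero)
      also have "\<dots> = (\<integral>\<omega>. cos (\<theta>' + s \<bullet> U p \<omega> + V \<omega>) * f \<omega> \<partial>M) + (\<integral>\<omega>. cos (\<theta>' + s \<bullet> U p \<omega> - V \<omega>) * f \<omega> \<partial>M)"
        by (intro Bochner_Integration.integral_add integrable_cos_mult f) measurable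
      also have "\<dots> = 0" by (simp only: * insert.prems(4))
      finally show ?thesis by simp
    qed
    then have "(\<integral>\<omega>. indicator (A p) (U p \<omega>) * (cos (V \<omega>) * f \<omega>) \<partial>M) = 0"
      by (intro insert.prems(2)) (auto intro!: integrable_cos_mult f)
    then show ?thesis by (simp add: V_def mult.left_commute)
  qed
  have "(\<integral>\<omega>. (\<Prod>i\<in>K. indicator (A i) (U i \<omega>)) * (indicator (A p) (U p \<omega>) * f \<omega>) \<partial>M) = 0"
  proof (rule insert.IH)
    show "integrable M (\<lambda>\<omega>. indicator (A p) (U p \<omega>) * f \<omega>)"
      by (rule integrable_indicator_mult[OF Up Ap f])
  qed (use insert.prems step in auto)
  moreover have "(\<Prod>i\<in>insert p K. indicator (A i) (U i \<omega>)) * f \<omega>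
      = (\<Prod>i\<in>K. indicator (A i) (U i \<omega>)) * (indicator (A p) (U p \<omega>) * f \<omega>)" for \<omega>
    using insert.hyps by (simp add: ac_simps)
  ultimately show ?case by (simp only:)
qed

text \<open>Lower orthants are products of half-lines, so the product lemma applies with the
  coordinates of \<open>U\<close> as the family; a combination of these coordinates is an inner
  product \<open>t \<bullet> U \<omega>\<close>.\<close>

lemma integral_indicator_eq_0_if_cos:
  fixes U :: "'a \<Rightarrow> real ^ 'n" and f :: "'a \<Rightarrow> real"
  assumes U[measurable]: "U \<in> borel_measurable M" and f: "integrable M f"
    and cos: "\<And>\<theta> t. (\<integral>\<omega>. cos (\<theta> + t \<bullet> U \<omega>) * f \<omega> \<partial>M) = 0"
    and A: "A \<in> sets borel"
  shows "(\<integral>\<omega>. indicator A (U \<omega>) * f \<omega> \<partial>M) = 0"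
proof (rule integral_indicator_generator_eq_0[OF U f])
  show "(\<integral>\<omega>. f \<omega> \<partial>M) = 0" using cos[of 0 0] by simp
  show "Int_stable (range (\<lambda>a :: real ^ 'n. {..a}))" by (rule Int_stable_atMost_vec)
  show "sets borel = sigma_sets (space borel) (range (\<lambda>a :: real ^ 'n. {..a}))"
    by (subst borel_eq_atMost) simp
  fix B assume "B \<in> range (\<lambda>a :: real ^ 'n. {..a})"
  then obtain a where B: "B = {..a}" by auto
  have "(\<integral>\<omega>. (\<Prod>i\<in>UNIV. indicator {..a $ i} (U \<omega> $ i)) * f \<omega> \<partial>M) = 0"
  proof (rule integral_prod_indicator_eq_0_if_cos[OF finite _ _ f])
    show "(\<lambda>\<omega>. U \<omega> $ i) \<in> borel_measurable M" for i
      using borel_measurable_inner[OF U borel_measurable_const, of "axis i 1"]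
      by (simp add: cart_eq_inner_axis)
    then show "(\<integral>\<omega>. indicator A (U \<omega> $ i) * f \<omega> \<partial>M) = 0"
      if "integrable M f" "\<And>\<theta> t. (\<integral>\<omega>. cos (\<theta> + t \<bullet> U \<omega> $ i) * f \<omega> \<partial>M) = 0" "A \<in> sets borel" for i f A
      using that by (intro integral_indicator_eq_0_if_cos_real) auto
    show "(\<integral>\<omega>. cos (\<theta> + (\<Sum>i\<in>UNIV. t i \<bullet> U \<omega> $ i)) * f \<omega> \<partial>M) = 0" for \<theta> t
      using cos[of \<theta> "\<chi> i. t i"] by (simp add: inner_vec_def)
  qed simp
  moreover have "(\<Prod>i\<in>UNIV. indicator {..a $ i} (U \<omega> $ i)) = (indicator B (U \<omega>) :: real)" for \<omega>
    by (auto simp: B less_eq_vec_def indicator_def)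
  ultimately show "(\<integral>\<omega>. indicator B (U \<omega>) * f \<omega> \<partial>M) = 0" by simp
qed (use A in auto)

text \<open>Second use of the product lemma, now with whole vectors as coordinates: boxes form an
  intersection-stable generator of the product sigma-algebra.\<close>

lemma integral_indicator_PiM_eq_0_if_cos:
  fixes x :: "'i \<Rightarrow> 'a \<Rightarrow> real ^ 'n" and f :: "'a \<Rightarrow> real"
  assumes J: "finite J" and x: "\<And>i. i \<in> J \<Longrightarrow> x i \<in> borel_measurable M" and f: "integrable M f"
    and cos: "\<And>\<theta> t. (\<integral>\<omega>. cos (\<theta> + (\<Sum>i\<in>J. t i \<bullet> x i \<omega>)) * f \<omega> \<partial>M) = 0"
    and A: "A \<in> sets (\<Pi>\<^sub>M i\<in>J. borel)"
  shows "(\<integral>\<omega>. indicator A (\<lambda>i\<in>J. x i \<omega>) * f \<omega> \<partial>M) = 0"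
proof (rule integral_indicator_generator_eq_0[OF _ f])
  \<comment> \<open>The generator has the shape required by \<open>sets_PiM_finite\<close>. Since
    \<open>J\<close> is finite, its finiteness condition restricts only the values of
    \<open>X\<close> outside \<open>J\<close>.\<close>
  let ?G = "{\<Pi>\<^sub>E i\<in>J. X i |X. (\<forall>i. X i \<in> sets borel) \<and> finite {i. X i \<noteq> space borel}} :: ('i \<Rightarrow> real ^ 'n) set set"
  show "(\<lambda>\<omega>. \<lambda>i\<in>J. x i \<omega>) \<in> measurable M (\<Pi>\<^sub>M i\<in>J. borel)"
    using x by (intro measurable_restrict) auto
  show "(\<integral>\<omega>. f \<omega> \<partial>M) = 0" using cos[of 0 "\<lambda>_. 0"] by simp
  show "Int_stable ?G"
  proof (rule Int_stableI)
    fix a b assume "a \<in> ?G" "b \<in> ?G"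
    then obtain X Y where *: "a = (\<Pi>\<^sub>E i\<in>J. X i)" "b = (\<Pi>\<^sub>E i\<in>J. Y i)"
      and X: "\<And>i. X i \<in> sets borel" "finite {i. X i \<noteq> space borel}"
      and Y: "\<And>i. Y i \<in> sets borel" "finite {i. Y i \<noteq> space borel}" by auto
    have "finite {i. X i \<inter> Y i \<noteq> space borel}"
      by (rule finite_subset[OF _ finite_UnI[OF X(2) Y(2)]]) auto
    then show "a \<inter> b \<in> ?G" using X Y
      by (auto simp: * PiE_Int intro!: exI[of _ "\<lambda>i. X i \<inter> Y i"])
  qed
  show "?G \<subseteq> Pow (space (\<Pi>\<^sub>M i\<in>J. borel))" by (auto simp: space_PiM)
  show "sets (\<Pi>\<^sub>M i\<in>J. borel) = sigma_sets (space (\<Pi>\<^sub>M i\<in>J. borel)) ?G"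
    unfolding space_PiM by (rule sets_PiM_finite)
  fix B assume "B \<in> ?G"
  then obtain X where B: "B = (\<Pi>\<^sub>E i\<in>J. X i)" and X: "\<And>i. X i \<in> sets borel" by auto
  have "(\<integral>\<omega>. (\<Prod>i\<in>J. indicator (X i) (x i \<omega>)) * f \<omega> \<partial>M) = 0"
    by (rule integral_prod_indicator_eq_0_if_cos[OF J x _ f cos X])
      (auto intro: integral_indicator_eq_0_if_cos x)
  moreover have "(\<Prod>i\<in>J. indicator (X i) (x i \<omega>)) = (indicator B (\<lambda>i\<in>J. x i \<omega>) :: real)" for \<omega>
    using J by (auto simp: B indicator_def PiE_iff)
  ultimately show "(\<integral>\<omega>. indicator B (\<lambda>i\<in>J. x i \<omega>) * f \<omega> \<partial>M) = 0" by simp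
qed (fact A)

end

section \<open>Conditional expectations given a finite family\<close>

lemma space_generated_by[simp]: "space (generated_by M J x) = space M"
  by (simp add: generated_by_def)

text \<open>Minimality of the generated sigma-algebra, stated for an arbitrary \<open>L\<close>:
  with \<open>L = M\<close> it yields a subalgebra of \<open>M\<close>, and with \<open>L\<close>
  generated by a larger family it yields monotonicity in the index set.\<close>

lemma sets_generated_by_subset:
  assumes "space L = space M" "\<And>i. i \<in> J \<Longrightarrow> x i \<in> borel_measurable L"
  shows "sets (generated_by M J x) \<subseteq> sets L"
proof
  fix A assume "A \<in> sets (generated_by M J x)"
  then obtain B where B: "B \<in> sets (\<Pi>\<^sub>M i\<in>J. borel)"
    and A: "A = (\<lambda>\<omega>. \<lambda>i\<in>J. x i \<omega>) -` B \<inter> space M"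
    unfolding generated_by_def
    by (subst (asm) sets_vimage_algebra2) (auto simp: space_PiM)
  have "(\<lambda>\<omega>. \<lambda>i\<in>J. x i \<omega>) \<in> measurable L (\<Pi>\<^sub>M i\<in>J. borel)"
    using assms by (intro measurable_restrict) auto
  from measurable_sets[OF this B] show "A \<in> sets L" by (simp add: A assms)
qed

lemma subalgebra_generated_by:
  assumes "\<And>i. i \<in> J \<Longrightarrow> x i \<in> borel_measurable M"
  shows "subalgebra M (generated_by M J x)"
  using sets_generated_by_subset[OF refl assms] by (simp add: subalgebra_def)

lemma measurable_generated_by:
  assumes "i \<in> J"
  shows "x i \<in> borel_measurable (generated_by M J x)"
proof -
  have "(\<lambda>\<omega>. \<lambda>i\<in>J. x i \<omega>) \<in> measurable (generated_by M J x) (\<Pi>\<^sub>M i\<in>J. borel)"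
    unfolding generated_by_def by (rule measurable_vimage_algebra1) (auto simp: space_PiM)
  from measurable_compose[OF this measurable_component_singleton[OF assms]] show ?thesis
    using assms by simp
qed

lemma sets_generated_by_mono:
  assumes "J \<subseteq> J'"
  shows "sets (generated_by M J x) \<subseteq> sets (generated_by M J' x)"
  using assms by (intro sets_generated_by_subset) (auto intro: measurable_generated_by)

lemma (in sigma_finite_subalgebra) integral_mult_eq_0_if_cond_exp_eq_0:
  assumes "AE \<omega> in M. real_cond_exp M F f \<omega> = 0" "h \<in> borel_measurable F"
    "f \<in> borel_measurable M" "integrable M (\<lambda>\<omega>. h \<omega> * f \<omega>)"
  shows "(\<integral>\<omega>. h \<omega> * f \<omega> \<partial>M) = 0"
proof -
  have "(\<integral>\<omega>. h \<omega> * f \<omega> \<partial>M) = (\<integral>\<omega>. h \<omega> * real_cond_exp M F f \<omega> \<partial>M)"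
    by (rule real_cond_exp_intg(2)[symmetric]) fact+
  also have "\<dots> = 0" using assms(1) by (intro integral_eq_zero_AE) auto
  finally show ?thesis .
qed

section \<open>Equality of conditional expectations in dual form; moments of normal
  variables\<close>

context prob_space
begin

lemma sigma_finite_subalgebra_if_subalgebra:
  "subalgebra M F \<Longrightarrow> sigma_finite_subalgebra M F"
  by (intro finite_measure_subalgebra_is_sigma_finite finite_measure_subalgebra.intro
      finite_measure_subalgebra_axioms.intro finite_measure_axioms)

text \<open>This bound allows a conditional probability to multiply a merely integrable function
  without loss of integrability.\<close>

lemma real_cond_exp_indicator_bounds:
  assumes F: "subalgebra M F" and G: "G \<in> sets M"
  shows "AE \<omega> in M. \<bar>real_cond_exp M F (indicator G) \<omega>\<bar> \<le> 1"
proof -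
  interpret F: sigma_finite_subalgebra M F
    using F by (rule sigma_finite_subalgebra_if_subalgebra)
  have int: "integrable M (indicator G :: 'a \<Rightarrow> real)" using G by (simp add: emeasure_eq_measure integrable_indicator_iff)
  have "AE \<omega> in M. real_cond_exp M F (indicator G) \<omega> \<ge> 0" "AE \<omega> in M. real_cond_exp M F (indicator G) \<omega> \<le> 1"
    using F.real_cond_exp_ge_c[OF int, of 0] F.real_cond_exp_le_c[OF int, of 1]
    by (auto simp: indicator_def)
  then show ?thesis by eventually_elim auto
qed

lemma integrable_mult_real_cond_exp_indicator:
  assumes F: "subalgebra M F" and G: "G \<in> sets M" and g: "integrable M g"
  shows "integrable M (\<lambda>\<omega>. g \<omega> * real_cond_exp M F (indicator G) \<omega>)"
  using g
proof (rule Bochner_Integration.integrable_bound)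
  interpret F: sigma_finite_subalgebra M F
    using F by (rule sigma_finite_subalgebra_if_subalgebra)
  show "(\<lambda>\<omega>. g \<omega> * real_cond_exp M F (indicator G) \<omega>) \<in> borel_measurable M"
    using g by auto
  show "AE \<omega> in M. norm (g \<omega> * real_cond_exp M F (indicator G) \<omega>) \<le> norm (g \<omega>)"
    using real_cond_exp_indicator_bounds[OF F G]
    by eventually_elim (auto simp: abs_mult intro: mult_right_le_one_le)
qed

lemma integrable_indicator_mult_set:
  fixes g :: "'a \<Rightarrow> real"
  assumes "G \<in> sets M" "integrable M g"
  shows "integrable M (\<lambda>\<omega>. g \<omega> * indicator G \<omega>)"
  using integrable_real_mult_indicator[OF assms] .

text \<open>Conditional expectation is self-adjoint: E[g P(G | F)] and E[E(g | F) 1_G] both equal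
  E[E(g | F) P(G | F)].\<close>

lemma integral_mult_innovation:
  assumes F: "subalgebra M F" and G: "G \<in> sets M" and g: "integrable M g"
  shows "(\<integral>\<omega>. g \<omega> * (indicator G \<omega> - real_cond_exp M F (indicator G) \<omega>) \<partial>M)
    = (\<integral>\<omega>. g \<omega> * indicator G \<omega> \<partial>M) - (\<integral>\<omega>. real_cond_exp M F g \<omega> * indicator G \<omega> \<partial>M)"
proof -
  interpret F: sigma_finite_subalgebra M F
    using F by (rule sigma_finite_subalgebra_if_subalgebra)
  let ?p = "real_cond_exp M F (indicator G)"
  have gp: "integrable M (\<lambda>\<omega>. g \<omega> * ?p \<omega>)"
    by (rule integrable_mult_real_cond_exp_indicator[OF F G g])
  have gG: "integrable M (\<lambda>\<omega>. g \<omega> * indicator G \<omega>)" by (rule integrable_indicator_mult_set[OF G g])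
  have "(\<integral>\<omega>. g \<omega> * ?p \<omega> \<partial>M) = (\<integral>\<omega>. ?p \<omega> * real_cond_exp M F g \<omega> \<partial>M)"
    using gp g by (subst F.real_cond_exp_intg(2)) (auto simp: mult.commute)
  also have "\<dots> = (\<integral>\<omega>. real_cond_exp M F g \<omega> * indicator G \<omega> \<partial>M)"
    using G integrable_indicator_mult_set[OF G F.real_cond_exp_int(1)[OF g]]
    by (subst F.real_cond_exp_intg(2)[symmetric]) (auto simp: mult.commute)
  finally show ?thesis using gp gG by (simp add: right_diff_distrib)
qed

text \<open>This dualises equality of conditional expectations: for a fixed event \<open>G\<close> the right-hand side
  is an integral of \<open>g\<close> against a fixed function, to which the trigonometric criteria apply.\<close>

lemma real_cond_exp_eq_iff_innovation:
  assumes F: "subalgebra M F" and F': "subalgebra M F'" and sub: "sets F \<subseteq> sets F'"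
    and g: "integrable M g"
  shows "(AE \<omega> in M. real_cond_exp M F' g \<omega> = real_cond_exp M F g \<omega>) \<longleftrightarrow>
    (\<forall>G\<in>sets F'. (\<integral>\<omega>. g \<omega> * (indicator G \<omega> - real_cond_exp M F (indicator G) \<omega>) \<partial>M) = 0)"
proof -
  interpret F: sigma_finite_subalgebra M F
    using F by (rule sigma_finite_subalgebra_if_subalgebra)
  interpret F': sigma_finite_subalgebra M F'
    using F' by (rule sigma_finite_subalgebra_if_subalgebra)
  have G: "G \<in> sets M" if "G \<in> sets F'" for G
    using that F' by (auto simp: subalgebra_def)
  have "real_cond_exp M F g \<in> borel_measurable F"
    by simp
  then have meas: "real_cond_exp M F g \<in> borel_measurable F'"
    using sub F F' by (auto intro: measurable_from_subalg simp: subalgebra_def)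
  \<comment> \<open>As an \<open>F'\<close>-measurable function, \<open>real_cond_exp M F g\<close>
    is the conditional expectation given \<open>F'\<close> exactly if it has the right integrals
    over the sets of \<open>F'\<close>.\<close>
  have *: "(AE \<omega> in M. real_cond_exp M F' g \<omega> = real_cond_exp M F g \<omega>) \<longleftrightarrow>
    (\<forall>G\<in>sets F'. (\<integral>\<omega>. g \<omega> * indicator G \<omega> \<partial>M) = (\<integral>\<omega>. real_cond_exp M F g \<omega> * indicator G \<omega> \<partial>M))"
    (is "?L \<longleftrightarrow> ?R")
  proof
    assume ?L
    show ?R
    proof
      fix G assume GF: "G \<in> sets F'"
      have "(\<integral>\<omega>. g \<omega> * indicator G \<omega> \<partial>M) = (\<integral>\<omega>. real_cond_exp M F' g \<omega> * indicator G \<omega> \<partial>M)"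
        using F'.real_cond_exp_intA[OF g GF] by (simp add: set_lebesgue_integral_def mult.commute)
      also have "\<dots> = (\<integral>\<omega>. real_cond_exp M F g \<omega> * indicator G \<omega> \<partial>M)"
        using \<open>?L\<close> G[OF GF] by (intro integral_cong_AE) auto
      finally show "(\<integral>\<omega>. g \<omega> * indicator G \<omega> \<partial>M) = (\<integral>\<omega>. real_cond_exp M F g \<omega> * indicator G \<omega> \<partial>M)" .
    qed
  next
    assume ?R
    then show ?L
      using g meas
      by (intro F'.real_cond_exp_charact F.real_cond_exp_int)
        (auto simp: set_lebesgue_integral_def mult.commute)
  qed
  show ?thesis
    unfolding * using integral_mult_innovation[OF F G g] by auto
qed

lemma real_cond_exp_generated_by_eq_0_if_cos:
  fixes x :: "nat \<Rightarrow> 'a \<Rightarrow> real ^ 'n"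
  assumes J: "finite J" and x: "\<And>i. i \<in> J \<Longrightarrow> x i \<in> borel_measurable M" and f: "integrable M f"
    and cos: "\<And>\<theta> t. (\<integral>\<omega>. cos (\<theta> + (\<Sum>i\<in>J. t i \<bullet> x i \<omega>)) * f \<omega> \<partial>M) = 0"
  shows "AE \<omega> in M. real_cond_exp M (generated_by M J x) f \<omega> = 0"
proof -
  interpret F: sigma_finite_subalgebra M "generated_by M J x"
    by (intro sigma_finite_subalgebra_if_subalgebra subalgebra_generated_by x)
  show ?thesis
  proof (rule F.real_cond_exp_charact[OF _ f])
    fix A assume "A \<in> sets (generated_by M J x)"
    then obtain B where B: "B \<in> sets (\<Pi>\<^sub>M i\<in>J. borel)"
      and A: "A = (\<lambda>\<omega>. \<lambda>i\<in>J. x i \<omega>) -` B \<inter> space M"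
      unfolding generated_by_def
      by (subst (asm) sets_vimage_algebra2) (auto simp: space_PiM)
    have "(LINT \<omega>:A|M. f \<omega>) = (\<integral>\<omega>. indicator B (\<lambda>i\<in>J. x i \<omega>) * f \<omega> \<partial>M)"
      unfolding set_lebesgue_integral_def A
      by (intro Bochner_Integration.integral_cong) (auto simp: indicator_def)
    also have "\<dots> = 0"
      by (rule integral_indicator_PiM_eq_0_if_cos[OF J x f cos B])
    finally show "(LINT \<omega>:A|M. f \<omega>) = (LINT \<omega>:A|M. 0)" by simp
  qed auto
qed

text \<open>The hypothesis says that \<open>f\<close> has conditional expectation 0 given the
  sigma-algebra of \<open>U\<close>, and the factor \<open>U\<close> may be pulled out. This passes
  from indicators to an unbounded \<open>U\<close> without approximating it by simple
  functions.\<close>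

lemma integral_mult_eq_0_if_indicator:
  fixes U f :: "'a \<Rightarrow> real"
  assumes U: "U \<in> borel_measurable M" and f: "integrable M f" "integrable M (\<lambda>\<omega>. U \<omega> * f \<omega>)"
    and zero: "\<And>A. A \<in> sets borel \<Longrightarrow> (\<integral>\<omega>. indicator A (U \<omega>) * f \<omega> \<partial>M) = 0"
  shows "(\<integral>\<omega>. U \<omega> * f \<omega> \<partial>M) = 0"
proof -
  define F where "F = vimage_algebra (space M) U borel"
  have "subalgebra M F"
    using U by (auto simp: F_def subalgebra_def sets_vimage_algebra2 measurable_sets)
  then interpret F: sigma_finite_subalgebra M F by (rule sigma_finite_subalgebra_if_subalgebra)
  have UF: "U \<in> borel_measurable F" unfolding F_def by (rule measurable_vimage_algebra1) simp
  have "AE \<omega> in M. real_cond_exp M F f \<omega> = 0"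
  proof (rule F.real_cond_exp_charact[OF _ f(1)])
    fix A assume "A \<in> sets F"
    then obtain B where "B \<in> sets borel" "A = U -` B \<inter> space M"
      by (auto simp: F_def sets_vimage_algebra2)
    then have "(LINT \<omega>:A|M. f \<omega>) = (\<integral>\<omega>. indicator B (U \<omega>) * f \<omega> \<partial>M)"
      unfolding set_lebesgue_integral_def
      by (intro Bochner_Integration.integral_cong) (auto simp: indicator_def)
    with zero[OF \<open>B \<in> _\<close>] show "(LINT \<omega>:A|M. f \<omega>) = (LINT \<omega>:A|M. 0)" by simp
  qed auto
  then show ?thesis
    by (rule F.integral_mult_eq_0_if_cond_exp_eq_0[OF _ UF _ f(2)]) (use f in auto)
qed

text \<open>A centred normal law, degenerate or not, is determined by its second moment. The phase
  combines the cosine part of the characteristic function with the sine part, which vanishes by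
  symmetry; other frequencies arise by rescaling \<open>Z\<close>.\<close>

lemma normal_rv_moments:
  assumes Z: "normal_rv M Z" and mean: "(\<integral>\<omega>. Z \<omega> \<partial>M) = 0"
  shows "integrable M (\<lambda>\<omega>. (Z \<omega>)\<^sup>2)"
    and "(\<integral>\<omega>. cos (\<theta> + Z \<omega>) \<partial>M) = cos \<theta> * exp (- (\<integral>\<omega>. (Z \<omega>)\<^sup>2 \<partial>M) / 2)"
proof -
  have [measurable]: "Z \<in> borel_measurable M" using Z by (simp add: normal_rv_def)
  consider \<mu> where "AE \<omega> in M. Z \<omega> = \<mu>"
    | \<mu> \<sigma> where "\<sigma> > 0" "distributed M lborel Z (normal_density \<mu> \<sigma>)"
    using Z by (auto simp: normal_rv_def)
  then have "integrable M (\<lambda>\<omega>. (Z \<omega>)\<^sup>2) \<and>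
    (\<integral>\<omega>. cos (\<theta> + Z \<omega>) \<partial>M) = cos \<theta> * exp (- (\<integral>\<omega>. (Z \<omega>)\<^sup>2 \<partial>M) / 2)"
  proof cases
    \<comment> \<open>The degenerate case: the almost sure constant is the mean, hence 0, and the
      formula holds with variance 0.\<close>
    case (1 \<mu>)
    have "(\<integral>\<omega>. Z \<omega> \<partial>M) = (\<integral>\<omega>. \<mu> \<partial>M)"
      using 1 by (intro integral_cong_AE) auto
    with mean have [simp]: "\<mu> = 0" by (simp add: prob_space)
    have "integrable M (\<lambda>\<omega>. (Z \<omega>)\<^sup>2) \<longleftrightarrow> integrable M (\<lambda>\<omega>. 0 :: real)"
      using 1 by (intro integrable_cong_AE) auto
    moreover have "(\<integral>\<omega>. cos (\<theta> + Z \<omega>) \<partial>M) = (\<integral>\<omega>. cos \<theta> \<partial>M)"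
      using 1 by (intro integral_cong_AE) auto
    moreover have "(\<integral>\<omega>. (Z \<omega>)\<^sup>2 \<partial>M) = (\<integral>\<omega>. 0 \<partial>M)"
      using 1 by (intro integral_cong_AE) auto
    ultimately show ?thesis by (simp add: prob_space)
  next
    case (2 \<mu> \<sigma>)
    have "\<mu> = 0" using normal_distributed_expectation[OF 2] mean by simp
    then have D: "distributed M lborel Z (normal_density 0 \<sigma>)" using 2 by simp
    have sq: "(\<integral>\<omega>. (Z \<omega>)\<^sup>2 \<partial>M) = \<sigma>\<^sup>2"
      using normal_distributed_variance[OF 2(1) D] mean by simp
    have int: "integrable M (\<lambda>\<omega>. (Z \<omega>)\<^sup>2)"
      using distributed_integrable[OF D, of "\<lambda>z. z\<^sup>2"] integrable_normal_moment[OF 2(1), of 0 2]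
      by (simp add: normal_density_nonneg)
    \<comment> \<open>Standardisation reduces the claim to the characteristic function of the
      standard normal law, evaluated at \<sigma>: its real part is exp (-\<sigma>^2 / 2) and its
      imaginary part is 0.\<close>
    define W where "W = (\<lambda>\<omega>. Z \<omega> / \<sigma>)"
    have W: "distributed M lborel W std_normal_density"
      using D normal_standard_normal_convert[OF 2(1), of Z 0] by (simp add: W_def)
    have [measurable]: "W \<in> borel_measurable M" unfolding W_def by measurable
    have distr: "distr M lborel W = std_normal_distribution"
      using W by (simp add: distributed_def)
    interpret R: real_distribution std_normal_distribution by (rule real_dist_normal_dist)
    have I: "complex_integrable std_normal_distribution (\<lambda>w. iexp (\<sigma> * w))"
      by (rule R.integrable_iexp) simp_all
    have pull: "(\<integral>\<omega>. g (\<sigma> * W \<omega>) \<partial>M) = (\<integral>w. g (\<sigma> * w) \<partial>std_normal_distribution)"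
      if [measurable]: "g \<in> borel_measurable borel" for g :: "real \<Rightarrow> real"
      unfolding distr[symmetric] by (subst integral_distr) auto
    have "(\<integral>w. cos (\<sigma> * w) \<partial>std_normal_distribution) = Re (char std_normal_distribution \<sigma>)"
      "(\<integral>w. sin (\<sigma> * w) \<partial>std_normal_distribution) = Im (char std_normal_distribution \<sigma>)"
      unfolding char_def integral_Re[OF I, symmetric] integral_Im[OF I, symmetric]
      by (simp_all add: Re_exp Im_exp)
    then have "(\<integral>\<omega>. cos (\<sigma> * W \<omega>) \<partial>M) = exp (- \<sigma>\<^sup>2 / 2)" "(\<integral>\<omega>. sin (\<sigma> * W \<omega>) \<partial>M) = 0"
      unfolding char_std_normal_distribution by (simp_all add: pull)
    moreover have "\<sigma> * W \<omega> = Z \<omega>" for \<omega> using 2(1) by (simp add: W_def)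
    ultimately have "(\<integral>\<omega>. cos (Z \<omega>) \<partial>M) = exp (- \<sigma>\<^sup>2 / 2)" "(\<integral>\<omega>. sin (Z \<omega>) \<partial>M) = 0" by simp_all
    moreover have "integrable M (\<lambda>\<omega>. cos (Z \<omega>))" "integrable M (\<lambda>\<omega>. sin (Z \<omega>))"
      by (auto intro!: integrable_const_bound[where B = 1])
    ultimately show ?thesis using int sq by (simp add: cos_add)
  qed
  then show "integrable M (\<lambda>\<omega>. (Z \<omega>)\<^sup>2)"
    and "(\<integral>\<omega>. cos (\<theta> + Z \<omega>) \<partial>M) = cos \<theta> * exp (- (\<integral>\<omega>. (Z \<omega>)\<^sup>2 \<partial>M) / 2)" by auto
qed

end

section \<open>Square-integrable functions\<close>

text \<open>These are functions, not classes modulo null sets, so the seminorm may vanish on nonzero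
  elements; orthogonalisation has to allow for that.\<close>

definition square_integrable :: "'a measure \<Rightarrow> ('a \<Rightarrow> real) set" where
  "square_integrable M = {f \<in> borel_measurable M. integrable M (\<lambda>\<omega>. (f \<omega>)\<^sup>2)}"

lemma square_integrable_measurable: "f \<in> square_integrable M \<Longrightarrow> f \<in> borel_measurable M"
  by (simp add: square_integrable_def)

lemma integrable_mult_square_integrable:
  assumes f: "f \<in> square_integrable M" and g: "g \<in> square_integrable M"
  shows "integrable M (\<lambda>\<omega>. f \<omega> * g \<omega>)"
proof (rule Bochner_Integration.integrable_bound)
  show "integrable M (\<lambda>\<omega>. (f \<omega>)\<^sup>2 + (g \<omega>)\<^sup>2)"
    using f g by (simp add: square_integrable_def)
  show "(\<lambda>\<omega>. f \<omega> * g \<omega>) \<in> borel_measurable M"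
    by (intro borel_measurable_times square_integrable_measurable f g)
  have "\<bar>a * b\<bar> \<le> a\<^sup>2 + b\<^sup>2" for a b :: real
  proof -
    have "2 * (\<bar>a\<bar> * \<bar>b\<bar>) \<le> a\<^sup>2 + b\<^sup>2"
      using sum_squares_bound[of "\<bar>a\<bar>" "\<bar>b\<bar>"] by (simp add: mult.assoc)
    moreover have "\<bar>a\<bar> * \<bar>b\<bar> \<ge> 0" by simp
    ultimately show ?thesis unfolding abs_mult by linarith
  qed
  then show "AE \<omega> in M. norm (f \<omega> * g \<omega>) \<le> norm ((f \<omega>)\<^sup>2 + (g \<omega>)\<^sup>2)" by simp
qed

lemma square_integrable_add:
  assumes "f \<in> square_integrable M" "g \<in> square_integrable M"
  shows "(\<lambda>\<omega>. f \<omega> + g \<omega>) \<in> square_integrable M"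
  using assms integrable_mult_square_integrable[OF assms]
  by (auto simp: square_integrable_def power2_sum mult.assoc)

lemma square_integrable_scale:
  "f \<in> square_integrable M \<Longrightarrow> (\<lambda>\<omega>. c * f \<omega>) \<in> square_integrable M"
  by (auto simp: square_integrable_def power_mult_distrib)

lemma square_integrable_diff:
  assumes "f \<in> square_integrable M" "g \<in> square_integrable M"
  shows "(\<lambda>\<omega>. f \<omega> - g \<omega>) \<in> square_integrable M"
  using square_integrable_add[OF assms(1) square_integrable_scale[OF assms(2), of "-1"]] by simp

lemma square_integrable_sum:
  "(\<And>i. i \<in> K \<Longrightarrow> f i \<in> square_integrable M) \<Longrightarrow> (\<lambda>\<omega>. \<Sum>i\<in>K. f i \<omega>) \<in> square_integrable M"
proof (induction K rule: infinite_finite_induct)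
  case (insert i K)
  then show ?case by (simp add: square_integrable_add)
qed (simp_all add: square_integrable_def)

lemma integral_add_mult:
  assumes "f \<in> square_integrable M" "g \<in> square_integrable M" "h \<in> square_integrable M"
  shows "(\<integral>\<omega>. (f \<omega> + g \<omega>) * h \<omega> \<partial>M) = (\<integral>\<omega>. f \<omega> * h \<omega> \<partial>M) + (\<integral>\<omega>. g \<omega> * h \<omega> \<partial>M)"
  unfolding distrib_right
  by (intro Bochner_Integration.integral_add integrable_mult_square_integrable assms)

lemma integral_diff_mult:
  assumes "f \<in> square_integrable M" "g \<in> square_integrable M" "h \<in> square_integrable M"
  shows "(\<integral>\<omega>. (f \<omega> - g \<omega>) * h \<omega> \<partial>M) = (\<integral>\<omega>. f \<omega> * h \<omega> \<partial>M) - (\<integral>\<omega>. g \<omega> * h \<omega> \<partial>M)"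
  unfolding left_diff_distrib
  by (intro Bochner_Integration.integral_diff integrable_mult_square_integrable assms)

lemma integral_sum_mult:
  assumes "\<And>i. i \<in> K \<Longrightarrow> f i \<in> square_integrable M" "h \<in> square_integrable M"
  shows "(\<integral>\<omega>. (\<Sum>i\<in>K. f i \<omega>) * h \<omega> \<partial>M) = (\<Sum>i\<in>K. (\<integral>\<omega>. f i \<omega> * h \<omega> \<partial>M))"
  unfolding sum_distrib_right
  by (intro Bochner_Integration.integral_sum integrable_mult_square_integrable assms)

lemma integral_inner_mult_eq_0:
  fixes U :: "'a \<Rightarrow> real ^ 'n"
  assumes "\<And>m. (\<lambda>\<omega>. U \<omega> $ m) \<in> square_integrable M" "h \<in> square_integrable M"
    and "\<And>m. (\<integral>\<omega>. U \<omega> $ m * h \<omega> \<partial>M) = 0"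
  shows "(\<integral>\<omega>. (t \<bullet> U \<omega>) * h \<omega> \<partial>M) = 0"
  unfolding inner_vec_def using assms
  by (subst integral_sum_mult) (auto intro: square_integrable_scale simp: mult.assoc)

text \<open>Gram--Schmidt, allowing linearly dependent \<open>v\<close>.\<close>

lemma ex_orthogonal_residual:
  assumes "finite K"
    and v: "\<And>i. i \<in> K \<Longrightarrow> v i \<in> square_integrable M"
    and u: "u \<in> square_integrable M"
  shows "\<exists>c. \<forall>j\<in>K. (\<integral>\<omega>. (u \<omega> - (\<Sum>i\<in>K. c i * v i \<omega>)) * v j \<omega> \<partial>M) = 0"
  using assms
proof (induction K arbitrary: u rule: finite_induct)
  case empty
  then show ?case by simp
next
  case (insert p K)
  note add = square_integrable_add and scale = square_integrable_scale
    and diff = square_integrable_diff and int = integrable_mult_square_integrable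
  note vL = insert.prems(1) and uL = insert.prems(2)
  have sum: "(\<lambda>\<omega>. \<Sum>i\<in>K. c i * v i \<omega>) \<in> square_integrable M" for c
    by (intro square_integrable_sum scale vL) simp
  obtain c where c: "\<And>j. j \<in> K \<Longrightarrow> (\<integral>\<omega>. (u \<omega> - (\<Sum>i\<in>K. c i * v i \<omega>)) * v j \<omega> \<partial>M) = 0"
    using insert.IH[of u] insert.prems by auto
  obtain d where d: "\<And>j. j \<in> K \<Longrightarrow> (\<integral>\<omega>. (v p \<omega> - (\<Sum>i\<in>K. d i * v i \<omega>)) * v j \<omega> \<partial>M) = 0"
    using insert.IH[of "v p"] insert.prems by auto
  define u' where "u' = (\<lambda>\<omega>. u \<omega> - (\<Sum>i\<in>K. c i * v i \<omega>))"
  define w where "w = (\<lambda>\<omega>. v p \<omega> - (\<Sum>i\<in>K. d i * v i \<omega>))"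
  have u'L: "u' \<in> square_integrable M" unfolding u'_def by (intro diff uL sum)
  have wL: "w \<in> square_integrable M" unfolding w_def by (intro diff vL sum) simp
  \<comment> \<open>The coefficient of the projection of \<open>u'\<close> onto \<open>w\<close>. If
    \<open>w\<close> is almost surely 0, division by zero gives \<beta> = 0, which is consistent
    because \<open>u' \<omega> * w \<omega>\<close> then has integral 0 as well.\<close>
  define \<beta> where "\<beta> = (\<integral>\<omega>. u' \<omega> * w \<omega> \<partial>M) / (\<integral>\<omega>. w \<omega> * w \<omega> \<partial>M)"
  define r where "r = (\<lambda>\<omega>. u' \<omega> - \<beta> * w \<omega>)"
  have rL: "r \<in> square_integrable M" unfolding r_def by (intro diff scale u'L wL)
  have uw: "(\<integral>\<omega>. u' \<omega> * w \<omega> \<partial>M) = \<beta> * (\<integral>\<omega>. w \<omega> * w \<omega> \<partial>M)"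
  proof (cases "(\<integral>\<omega>. w \<omega> * w \<omega> \<partial>M) = 0")
    case True
    then have "AE \<omega> in M. w \<omega> * w \<omega> = 0"
      using integral_nonneg_eq_0_iff_AE[OF int[OF wL wL]] by simp
    then have "(\<integral>\<omega>. u' \<omega> * w \<omega> \<partial>M) = 0" by (intro integral_eq_zero_AE) auto
    then show ?thesis using True by simp
  qed (simp add: \<beta>_def)
  have r: "(\<integral>\<omega>. r \<omega> * f \<omega> \<partial>M) = (\<integral>\<omega>. u' \<omega> * f \<omega> \<partial>M) - \<beta> * (\<integral>\<omega>. w \<omega> * f \<omega> \<partial>M)"
    if "f \<in> square_integrable M" for f
    unfolding r_def using integral_diff_mult[OF u'L scale[OF wL] that] by (simp add: mult.assoc)
  have rK: "(\<integral>\<omega>. r \<omega> * v j \<omega> \<partial>M) = 0" if "j \<in> K" for j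
    using that c[OF that] d[OF that] r[OF vL] by (simp add: u'_def w_def)
  have rw: "(\<integral>\<omega>. r \<omega> * w \<omega> \<partial>M) = 0" using r[OF wL] uw by simp
  have rp: "(\<integral>\<omega>. r \<omega> * v p \<omega> \<partial>M) = 0"
  proof -
    have "(\<integral>\<omega>. r \<omega> * v p \<omega> \<partial>M) = (\<integral>\<omega>. (w \<omega> + (\<Sum>i\<in>K. d i * v i \<omega>)) * r \<omega> \<partial>M)"
      by (simp add: w_def mult.commute)
    also have "\<dots> = (\<integral>\<omega>. w \<omega> * r \<omega> \<partial>M) + (\<Sum>i\<in>K. (\<integral>\<omega>. d i * v i \<omega> * r \<omega> \<partial>M))"
      by (simp add: integral_add_mult integral_sum_mult wL rL sum scale vL)
    also have "\<dots> = (\<integral>\<omega>. r \<omega> * w \<omega> \<partial>M) + (\<Sum>i\<in>K. d i * (\<integral>\<omega>. r \<omega> * v i \<omega> \<partial>M))"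
      unfolding mult.assoc by (simp add: mult.commute[of _ "r _"])
    finally show ?thesis using rw rK by simp
  qed
  \<comment> \<open>Collects the coefficients of the \<open>v i\<close> in u - sum c v - \<beta> (v
    p - sum d v), which is \<open>r\<close>.\<close>
  define e where "e = (\<lambda>i. if i = p then \<beta> else c i - \<beta> * d i)"
  have "u \<omega> - (\<Sum>i\<in>insert p K. e i * v i \<omega>) = r \<omega>" for \<omega>
  proof -
    have "(\<Sum>i\<in>K. e i * v i \<omega>) = (\<Sum>i\<in>K. c i * v i \<omega>) - \<beta> * (\<Sum>i\<in>K. d i * v i \<omega>)"
      unfolding sum_distrib_left sum_subtractf[symmetric]
      using insert.hyps by (intro sum.cong) (auto simp: e_def algebra_simps)
    then show ?thesis using insert.hyps by (simp add: r_def u'_def w_def e_def algebra_simps)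
  qed
  then show ?case using rK rp by (intro exI[of _ e]) auto
qed

section \<open>Gaussian families\<close>

locale gaussian_family = prob_space M
  for M :: "'a measure" +
  fixes I :: "nat set" and x :: "nat \<Rightarrow> 'a \<Rightarrow> real ^ 'd"
  assumes finite_I: "finite I"
    and gaussian: "gaussian_seq M I x"
    and zero_mean: "zero_mean_seq M I x"
begin

text \<open>Joint Gaussianity speaks of combinations over all of \<open>I\<close>. Components,
  partial sums and residuals are brought into this form by zero coefficients, so that normality,
  centring and square integrability are established only once.\<close>

definition lin :: "(nat \<Rightarrow> real ^ 'd) \<Rightarrow> 'a \<Rightarrow> real" where
  "lin a \<omega> = (\<Sum>k\<in>I. a k \<bullet> x k \<omega>)"

lemma measurable_x: "k \<in> I \<Longrightarrow> x k \<in> borel_measurable M"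
  using gaussian by (auto simp: gaussian_seq_def)

lemma measurable_lin[measurable]: "lin a \<in> borel_measurable M"
  using gaussian by (simp add: gaussian_seq_def normal_rv_def lin_def[abs_def])

lemma lin_add: "lin (\<lambda>k. a k + b k) \<omega> = lin a \<omega> + lin b \<omega>"
  by (simp add: lin_def inner_add_left sum.distrib)

lemma lin_diff: "lin (\<lambda>k. a k - b k) \<omega> = lin a \<omega> - lin b \<omega>"
  by (simp add: lin_def inner_diff_left sum_subtractf)

lemma lin_scaleR: "lin (\<lambda>k. t *\<^sub>R a k) \<omega> = t * lin a \<omega>"
  by (simp add: lin_def sum_distrib_left)

lemma lin_restrict:
  assumes "J \<subseteq> I"
  shows "(\<Sum>i\<in>J. a i \<bullet> x i \<omega>) = lin (\<lambda>i. if i \<in> J then a i else 0) \<omega>"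
  unfolding lin_def using assms finite_I
  by (intro sum.mono_neutral_cong_left) auto

lemma lin_single:
  assumes "k \<in> I"
  shows "t \<bullet> x k \<omega> = lin (\<lambda>i. if i = k then t else 0) \<omega>"
  using lin_restrict[of "{k}" "\<lambda>_. t" \<omega>] assms by simp

lemma lin_component:
  assumes "k \<in> I"
  shows "x k \<omega> $ m = lin (\<lambda>i. if i = k then axis m 1 else 0) \<omega>"
  using lin_single[OF assms, of "axis m 1" \<omega>] by (simp add: inner_commute cart_eq_inner_axis)

lemma normal_lin: "normal_rv M (lin a)"
  using gaussian by (simp add: gaussian_seq_def lin_def[abs_def])

lemma integrable_inner_x: "k \<in> I \<Longrightarrow> integrable M (\<lambda>\<omega>. t \<bullet> x k \<omega>)"
  using zero_mean by (auto simp: zero_mean_seq_def)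

lemma integrable_lin: "integrable M (lin a)"
  unfolding lin_def[abs_def] by (intro Bochner_Integration.integrable_sum integrable_inner_x)

lemma integral_lin: "(\<integral>\<omega>. lin a \<omega> \<partial>M) = 0"
proof -
  have "(\<integral>\<omega>. lin a \<omega> \<partial>M) = (\<Sum>k\<in>I. (\<integral>\<omega>. a k \<bullet> x k \<omega> \<partial>M))"
    unfolding lin_def by (intro Bochner_Integration.integral_sum integrable_inner_x)
  also have "\<dots> = 0"
    using zero_mean by (intro sum.neutral) (auto simp: zero_mean_seq_def)
  finally show ?thesis .
qed

lemma square_integrable_lin: "lin a \<in> square_integrable M"
  using normal_rv_moments(1)[OF normal_lin integral_lin] by (simp add: square_integrable_def)

lemma integrable_lin_power2: "integrable M (\<lambda>\<omega>. (lin a \<omega>)\<^sup>2)"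
  using square_integrable_lin by (simp add: square_integrable_def)

lemma integrable_lin_lin: "integrable M (\<lambda>\<omega>. lin a \<omega> * lin b \<omega>)"
  by (intro integrable_mult_square_integrable square_integrable_lin)

lemma square_integrable_inner: "k \<in> I \<Longrightarrow> (\<lambda>\<omega>. t \<bullet> x k \<omega>) \<in> square_integrable M"
  unfolding lin_single by (rule square_integrable_lin)

lemma square_integrable_component: "k \<in> I \<Longrightarrow> (\<lambda>\<omega>. x k \<omega> $ m) \<in> square_integrable M"
  unfolding lin_component by (rule square_integrable_lin)

lemma integral_component: "k \<in> I \<Longrightarrow> (\<integral>\<omega>. x k \<omega> $ m \<partial>M) = 0"
  unfolding lin_component by (rule integral_lin)

lemma integral_cos_lin:
  "(\<integral>\<omega>. cos (\<theta> + lin a \<omega>) \<partial>M) = cos \<theta> * exp (- (\<integral>\<omega>. (lin a \<omega>)\<^sup>2 \<partial>M) / 2)"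
  by (rule normal_rv_moments(2)[OF normal_lin integral_lin])

lemma integrable_cos: "V \<in> borel_measurable M \<Longrightarrow> integrable M (\<lambda>\<omega>. cos (V \<omega>) :: real)"
  by (rule integrable_const_bound[where B = 1]) auto

text \<open>Independence of uncorrelated combinations, tested on cosines. The product-to-sum formula
  leads to the combinations a + b and a - b; without a cross term both have variance V a + V b, so
  the exponential factors out and the expectation of the product splits.\<close>

lemma integral_cos_lin_uncorrelated:
  assumes "(\<integral>\<omega>. lin b \<omega> * lin a \<omega> \<partial>M) = 0"
  shows "(\<integral>\<omega>. cos (\<theta> + lin a \<omega>) * (cos (\<theta>' + lin b \<omega>) - (\<integral>\<omega>. cos (\<theta>' + lin b \<omega>) \<partial>M)) \<partial>M) = 0"
proof -
  define V where "V = (\<lambda>a. \<integral>\<omega>. (lin a \<omega>)\<^sup>2 \<partial>M)"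
  have "V (\<lambda>k. a k + b k) = (\<integral>\<omega>. (lin a \<omega>)\<^sup>2 + (lin b \<omega>)\<^sup>2 + 2 * (lin b \<omega> * lin a \<omega>) \<partial>M)"
    unfolding V_def by (intro Bochner_Integration.integral_cong) (auto simp: lin_add power2_sum)
  then have Vadd: "V (\<lambda>k. a k + b k) = V a + V b"
    using assms integrable_lin_power2 integrable_lin_lin by (simp add: V_def)
  have "V (\<lambda>k. a k - b k) = (\<integral>\<omega>. (lin a \<omega>)\<^sup>2 + (lin b \<omega>)\<^sup>2 - 2 * (lin b \<omega> * lin a \<omega>) \<partial>M)"
    unfolding V_def by (intro Bochner_Integration.integral_cong) (auto simp: lin_diff power2_diff)
  then have Vdiff: "V (\<lambda>k. a k - b k) = V a + V b"
    using assms integrable_lin_power2 integrable_lin_lin by (simp add: V_def)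
  have E: "(\<integral>\<omega>. cos (\<phi> + lin c \<omega>) \<partial>M) = cos \<phi> * exp (- V c / 2)" for \<phi> c
    unfolding V_def by (rule integral_cos_lin)
  have two: "2 * (cos (\<theta> + lin a \<omega>) * cos (\<theta>' + lin b \<omega>))
    = cos ((\<theta> + \<theta>') + lin (\<lambda>k. a k + b k) \<omega>) + cos ((\<theta> - \<theta>') + lin (\<lambda>k. a k - b k) \<omega>)" for \<omega>
  proof -
    have "2 * (cos s * cos t) = cos (s + t) + cos (s - t)" for s t :: real
      by (simp add: cos_add cos_diff)
    moreover have "\<theta> + lin a \<omega> + (\<theta>' + lin b \<omega>) = (\<theta> + \<theta>') + lin (\<lambda>k. a k + b k) \<omega>"
      "\<theta> + lin a \<omega> - (\<theta>' + lin b \<omega>) = (\<theta> - \<theta>') + lin (\<lambda>k. a k - b k) \<omega>"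
      by (simp_all add: lin_add lin_diff)
    ultimately show ?thesis by metis
  qed
  have "2 * (\<integral>\<omega>. cos (\<theta> + lin a \<omega>) * cos (\<theta>' + lin b \<omega>) \<partial>M)
      = (\<integral>\<omega>. cos ((\<theta> + \<theta>') + lin (\<lambda>k. a k + b k) \<omega>) + cos ((\<theta> - \<theta>') + lin (\<lambda>k. a k - b k) \<omega>) \<partial>M)"
    by (simp only: two flip: integral_mult_right_zero)
  also have "\<dots> = (\<integral>\<omega>. cos ((\<theta> + \<theta>') + lin (\<lambda>k. a k + b k) \<omega>) \<partial>M)
      + (\<integral>\<omega>. cos ((\<theta> - \<theta>') + lin (\<lambda>k. a k - b k) \<omega>) \<partial>M)"
    by (intro Bochner_Integration.integral_add integrable_cos) measurable
  also have "\<dots> = (cos (\<theta> + \<theta>') + cos (\<theta> - \<theta>')) * exp (- (V a + V b) / 2)"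
    by (simp only: E Vadd Vdiff distrib_right)
  also have "\<dots> = 2 * ((cos \<theta> * exp (- V a / 2)) * (cos \<theta>' * exp (- V b / 2)))"
  proof -
    have "exp (- (V a + V b) / 2) = exp (- V a / 2) * exp (- V b / 2)"
      by (simp add: add_divide_distrib diff_divide_distrib flip: exp_add)
    then show ?thesis by (simp add: cos_add cos_diff)
  qed
  finally have prod: "(\<integral>\<omega>. cos (\<theta> + lin a \<omega>) * cos (\<theta>' + lin b \<omega>) \<partial>M)
      = (cos \<theta> * exp (- V a / 2)) * (cos \<theta>' * exp (- V b / 2))" by simp
  have "(\<integral>\<omega>. cos (\<theta> + lin a \<omega>) * (cos (\<theta>' + lin b \<omega>) - cos \<theta>' * exp (- V b / 2)) \<partial>M)
    = (\<integral>\<omega>. cos (\<theta> + lin a \<omega>) * cos (\<theta>' + lin b \<omega>) - cos (\<theta> + lin a \<omega>) * (cos \<theta>' * exp (- V b / 2)) \<partial>M)"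
    by (simp only: right_diff_distrib)
  also have "\<dots> = (\<integral>\<omega>. cos (\<theta> + lin a \<omega>) * cos (\<theta>' + lin b \<omega>) \<partial>M)
      - (\<integral>\<omega>. cos (\<theta> + lin a \<omega>) * (cos \<theta>' * exp (- V b / 2)) \<partial>M)"
    by (intro Bochner_Integration.integral_diff integrable_cos_mult integrable_mult_left integrable_cos)
      measurable
  also have "(\<integral>\<omega>. cos (\<theta> + lin a \<omega>) * (cos \<theta>' * exp (- V b / 2)) \<partial>M)
      = (cos \<theta> * exp (- V a / 2)) * (cos \<theta>' * exp (- V b / 2))"
    by (subst integral_mult_left_zero) (simp only: E)
  finally show ?thesis by (simp only: E prod)
qed

lemma integral_lin_mult_sum:
  assumes J: "J \<subseteq> I" and orth: "\<And>i m. i \<in> J \<Longrightarrow> (\<integral>\<omega>. lin b \<omega> * x i \<omega> $ m \<partial>M) = 0"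
  shows "(\<integral>\<omega>. lin b \<omega> * (\<Sum>i\<in>J. t i \<bullet> x i \<omega>) \<partial>M) = 0"
proof -
  have "(\<integral>\<omega>. (\<Sum>i\<in>J. t i \<bullet> x i \<omega>) * lin b \<omega> \<partial>M) = (\<Sum>i\<in>J. (\<integral>\<omega>. (t i \<bullet> x i \<omega>) * lin b \<omega> \<partial>M))"
    using J by (intro integral_sum_mult square_integrable_inner square_integrable_lin) auto
  also have "\<dots> = 0"
    using J orth
    by (intro sum.neutral ballI integral_inner_mult_eq_0 square_integrable_component square_integrable_lin)
      (auto simp: mult.commute)
  finally show ?thesis by (simp add: mult.commute)
qed

section \<open>Independence of a residual from the family to which it is orthogonal\<close>

context
  fixes J b
  assumes J: "J \<subseteq> I" and orth: "\<And>i m. i \<in> J \<Longrightarrow> (\<integral>\<omega>. lin b \<omega> * x i \<omega> $ m \<partial>M) = 0"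
begin

interpretation F: sigma_finite_subalgebra M "generated_by M J x"
  using J by (intro sigma_finite_subalgebra_if_subalgebra subalgebra_generated_by measurable_x) auto

text \<open>Orthogonality to every component over \<open>J\<close> extends to all combinations over
  \<open>J\<close>, and the product formula for cosines then supplies the trigonometric
  criterion.\<close>

lemma cond_exp_cos_orthogonal:
  "AE \<omega> in M. real_cond_exp M (generated_by M J x)
     (\<lambda>\<omega>. cos (\<theta> + lin b \<omega>) - (\<integral>\<omega>. cos (\<theta> + lin b \<omega>) \<partial>M)) \<omega> = 0"
proof (rule real_cond_exp_generated_by_eq_0_if_cos)
  show "finite J" using J finite_I by (rule finite_subset)
  show "i \<in> J \<Longrightarrow> x i \<in> borel_measurable M" for i using J measurable_x by auto
  show "integrable M (\<lambda>\<omega>. cos (\<theta> + lin b \<omega>) - (\<integral>\<omega>. cos (\<theta> + lin b \<omega>) \<partial>M))"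
    by (intro Bochner_Integration.integrable_diff integrable_cos integrable_const) measurable
  show "(\<integral>\<omega>. cos (\<theta>' + (\<Sum>i\<in>J. t i \<bullet> x i \<omega>)) * (cos (\<theta> + lin b \<omega>) - (\<integral>\<omega>. cos (\<theta> + lin b \<omega>) \<partial>M)) \<partial>M) = 0"
    for \<theta>' t
    using integral_lin_mult_sum[OF J orth, of t]
    unfolding lin_restrict[OF J] by (intro integral_cos_lin_uncorrelated) auto
qed

text \<open>Independence in the form used for conditional CDFs: the second factor may be any
  integrable function measurable for the family over \<open>J\<close>, bounded or not.\<close>

lemma integral_mult_cos_orthogonal:
  assumes h: "h \<in> borel_measurable (generated_by M J x)" "integrable M h"
  shows "(\<integral>\<omega>. cos (\<theta> + lin b \<omega>) * h \<omega> \<partial>M) = (\<integral>\<omega>. cos (\<theta> + lin b \<omega>) \<partial>M) * (\<integral>\<omega>. h \<omega> \<partial>M)"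
proof -
  let ?m = "\<integral>\<omega>. cos (\<theta> + lin b \<omega>) \<partial>M"
  have int: "integrable M (\<lambda>\<omega>. cos (\<theta> + lin b \<omega>) * h \<omega>)"
    by (intro integrable_cos_mult h) measurable
  have eq: "h \<omega> * (cos (\<theta> + lin b \<omega>) - ?m) = cos (\<theta> + lin b \<omega>) * h \<omega> - ?m * h \<omega>" for \<omega>
    by (simp add: algebra_simps)
  have "(\<integral>\<omega>. h \<omega> * (cos (\<theta> + lin b \<omega>) - ?m) \<partial>M) = 0"
    by (rule F.integral_mult_eq_0_if_cond_exp_eq_0[OF cond_exp_cos_orthogonal h(1)])
      (use int h(2) in \<open>auto simp: eq\<close>)
  then show ?thesis using int h(2) by (simp add: eq)
qed

end

text \<open>The residual itself is unbounded, so the roles are exchanged: for a fixed event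
  \<open>G\<close>, the centred function 1_G - P(G) vanishes against all cosines of
  \<open>lin b\<close>, hence against all indicators of \<open>lin b\<close>, hence against
  \<open>lin b\<close>.\<close>

lemma cond_exp_orthogonal:
  assumes J: "J \<subseteq> I" and orth: "\<And>i m. i \<in> J \<Longrightarrow> (\<integral>\<omega>. lin b \<omega> * x i \<omega> $ m \<partial>M) = 0"
  shows "AE \<omega> in M. real_cond_exp M (generated_by M J x) (lin b) \<omega> = 0"
proof -
  interpret F: sigma_finite_subalgebra M "generated_by M J x"
    using J by (intro sigma_finite_subalgebra_if_subalgebra subalgebra_generated_by measurable_x) auto
  show ?thesis
  proof (rule F.real_cond_exp_charact[OF _ integrable_lin])
    fix G assume G: "G \<in> sets (generated_by M J x)"
    then have GM[measurable]: "G \<in> sets M" using F.subalg by (auto simp: subalgebra_def)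
    let ?p = "measure M G"
    have intG: "integrable M (indicator G :: 'a \<Rightarrow> real)"
      by (simp add: emeasure_eq_measure integrable_indicator_iff)
    then have int: "integrable M (\<lambda>\<omega>. indicator G \<omega> - ?p)" by simp
    have zero: "(\<integral>\<omega>. lin b \<omega> * (indicator G \<omega> - ?p) \<partial>M) = 0"
    proof (rule integral_mult_eq_0_if_indicator[OF measurable_lin int])
      show "integrable M (\<lambda>\<omega>. lin b \<omega> * (indicator G \<omega> - ?p))"
        using integrable_indicator_mult_set[OF GM integrable_lin] integrable_lin
        by (auto simp: right_diff_distrib)
      fix A :: "real set" assume "A \<in> sets borel"
      then show "(\<integral>\<omega>. indicator A (lin b \<omega>) * (indicator G \<omega> - ?p) \<partial>M) = 0"
      proof (rule integral_indicator_eq_0_if_cos_real[OF measurable_lin int, rotated])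
        fix \<theta> t
        \<comment> \<open>Scaling \<open>b\<close> preserves orthogonality, so the independence
          statement for one combination covers every frequency \<open>t\<close>.\<close>
        let ?b = "\<lambda>k. t *\<^sub>R b k"
        have "(\<integral>\<omega>. lin ?b \<omega> * x i \<omega> $ m \<partial>M) = 0" if "i \<in> J" for i m
          using orth[OF that] by (simp add: lin_scaleR mult.assoc)
        from integral_mult_cos_orthogonal[OF J this _ intG, of \<theta>] G
        have "(\<integral>\<omega>. cos (\<theta> + lin ?b \<omega>) * indicator G \<omega> \<partial>M) = (\<integral>\<omega>. cos (\<theta> + lin ?b \<omega>) \<partial>M) * ?p"
          by simp
        moreover have "integrable M (\<lambda>\<omega>. cos (\<theta> + lin ?b \<omega>))" by (intro integrable_cos) measurable
        moreover have "integrable M (\<lambda>\<omega>. cos (\<theta> + lin ?b \<omega>) * indicator G \<omega>)"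
          by (intro integrable_cos_mult intG) measurable
        ultimately have "(\<integral>\<omega>. cos (\<theta> + lin ?b \<omega>) * (indicator G \<omega> - ?p) \<partial>M) = 0"
          by (simp add: right_diff_distrib)
        then show "(\<integral>\<omega>. cos (\<theta> + t * lin b \<omega>) * (indicator G \<omega> - ?p) \<partial>M) = 0"
          by (simp add: lin_scaleR)
      qed
    qed
    have "(LINT \<omega>:G|M. lin b \<omega>) = (\<integral>\<omega>. lin b \<omega> * (indicator G \<omega> - ?p) + ?p * lin b \<omega> \<partial>M)"
      unfolding set_lebesgue_integral_def
      by (intro Bochner_Integration.integral_cong) (auto simp: algebra_simps)
    also have "\<dots> = 0"
      using integrable_indicator_mult_set[OF GM integrable_lin] integrable_lin integral_lin zero
      by (simp add: right_diff_distrib)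
    finally show "(LINT \<omega>:G|M. lin b \<omega>) = (LINT \<omega>:G|M. 0)" by simp
  qed auto
qed

section \<open>Linear prediction and conditional CDFs\<close>

lemma ex_linear_prediction:
  assumes J: "J \<subseteq> I"
  shows "\<exists>a. \<forall>i\<in>J. \<forall>m. (\<integral>\<omega>. (lin b \<omega> - (\<Sum>i\<in>J. a i \<bullet> x i \<omega>)) * x i \<omega> $ m \<partial>M) = 0"
proof -
  \<comment> \<open>Vectors are flattened to their scalar components, indexed by pairs, for
    Gram-Schmidt; the scalar coefficients are collected into vectors afterwards. With singular
    covariance they need not be unique.\<close>
  have "finite (J \<times> (UNIV :: 'd set))" using finite_subset[OF J finite_I] by simp
  then have "\<exists>c. \<forall>j\<in>J \<times> UNIV. (\<integral>\<omega>. (lin b \<omega> - (\<Sum>i\<in>J \<times> UNIV. c i * x (fst i) \<omega> $ snd i))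
      * x (fst j) \<omega> $ snd j \<partial>M) = 0"
  proof (rule ex_orthogonal_residual)
    fix i assume "i \<in> J \<times> (UNIV :: 'd set)"
    then have "fst i \<in> I" using J by auto
    then show "(\<lambda>\<omega>. x (fst i) \<omega> $ snd i) \<in> square_integrable M"
      by (rule square_integrable_component)
  qed (rule square_integrable_lin)
  then obtain c where c: "\<And>i m. i \<in> J \<Longrightarrow>
      (\<integral>\<omega>. (lin b \<omega> - (\<Sum>p\<in>J \<times> UNIV. c p * x (fst p) \<omega> $ snd p)) * x i \<omega> $ m \<partial>M) = 0"
    by fastforce
  have "(\<Sum>p\<in>J \<times> UNIV. c p * x (fst p) \<omega> $ snd p) = (\<Sum>i\<in>J. (\<chi> m. c (i, m)) \<bullet> x i \<omega>)" for \<omega>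
    by (simp add: inner_vec_def sum.cartesian_product split_def)
  with c show ?thesis by (intro exI[of _ "\<lambda>i. \<chi> m. c (i, m)"]) simp
qed

lemma lin_residual:
  assumes "J \<subseteq> I"
  shows "lin b \<omega> - (\<Sum>i\<in>J. a i \<bullet> x i \<omega>) = lin (\<lambda>i. b i - (if i \<in> J then a i else 0)) \<omega>"
  by (simp only: lin_restrict[OF assms] lin_diff)

text \<open>Each \<open>t \<bullet> x k \<omega>\<close> is a prediction \<open>S\<close>,
  measurable for the small sigma-algebra F, plus a residual independent of the large one F'. For u =
  1_G - P(G | F) with \<open>G\<close> in F', the addition theorem splits cos (\<theta> + t x_k) u
  into products of a cosine of the residual and an F'-measurable factor cos (\<psi> + S) u.
  Independence separates the two, and the second has integral 0 because E(u | F) = 0.\<close>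

lemma cond_cdf_eq_if_prediction:
  assumes JJ': "J \<subseteq> J'" "J' \<subseteq> I" and k: "k \<in> I"
    and pred: "\<And>l. \<exists>a. \<forall>i\<in>J'. \<forall>m. (\<integral>\<omega>. (x k \<omega> $ l - (\<Sum>i\<in>J. a i \<bullet> x i \<omega>)) * x i \<omega> $ m \<partial>M) = 0"
  shows "AE \<omega> in M. cond_cdf M x k J' \<xi> \<omega> = cond_cdf M x k J \<xi> \<omega>"
proof -
  let ?F = "generated_by M J x" and ?F' = "generated_by M J' x"
  have J: "J \<subseteq> I" by (rule order_trans[OF JJ'])
  have F: "subalgebra M ?F" and F': "subalgebra M ?F'"
    using subsetD[OF J] subsetD[OF JJ'(2)]
    by (simp_all add: subalgebra_generated_by measurable_x)
  interpret F: sigma_finite_subalgebra M ?F using F by (rule sigma_finite_subalgebra_if_subalgebra)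
  have sub: "sets ?F \<subseteq> sets ?F'" by (rule sets_generated_by_mono) fact
  have [measurable]: "x k \<in> borel_measurable M" using k by (rule measurable_x)
  have "\<forall>l. \<exists>a. \<forall>i\<in>J'. \<forall>m. (\<integral>\<omega>. (x k \<omega> $ l - (\<Sum>i\<in>J. a i \<bullet> x i \<omega>)) * x i \<omega> $ m \<partial>M) = 0"
    by (rule allI) (rule pred)
  from choice[OF this] obtain a where "\<forall>l. \<forall>i\<in>J'. \<forall>m.
      (\<integral>\<omega>. (x k \<omega> $ l - (\<Sum>i\<in>J. a l i \<bullet> x i \<omega>)) * x i \<omega> $ m \<partial>M) = 0" ..
  then have a: "(\<integral>\<omega>. (x k \<omega> $ l - (\<Sum>i\<in>J. a l i \<bullet> x i \<omega>)) * x i \<omega> $ m \<partial>M) = 0"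
    if "i \<in> J'" for l i m using that by blast
  define B where "B = {\<omega> \<in> space M. \<forall>i. x k \<omega> $ i \<le> \<xi> $ i}"
  have B_eq: "B = x k -` {..\<xi>} \<inter> space M" by (auto simp: B_def less_eq_vec_def)
  have "B \<in> sets M" unfolding B_eq by measurable
  then have intB: "integrable M (indicator B :: 'a \<Rightarrow> real)"
    by (simp add: emeasure_eq_measure integrable_indicator_iff)
  show ?thesis
    unfolding cond_cdf_def B_def[symmetric] real_cond_exp_eq_iff_innovation[OF F F' sub intB]
  proof
    fix G assume G: "G \<in> sets ?F'"
    then have GM: "G \<in> sets M" using F' by (auto simp: subalgebra_def)
    then have intG: "integrable M (indicator G :: 'a \<Rightarrow> real)"
      by (simp add: emeasure_eq_measure integrable_indicator_iff)
    define u where "u = (\<lambda>\<omega>. indicator G \<omega> - real_cond_exp M ?F (indicator G) \<omega>)"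
    have u: "integrable M u" unfolding u_def
      by (intro Bochner_Integration.integrable_diff intG F.real_cond_exp_int)
    have uF': "u \<in> borel_measurable ?F'"
    proof -
      have "real_cond_exp M ?F (indicator G) \<in> borel_measurable ?F'"
        using sub by (intro measurable_from_subalg[of ?F' ?F]) (auto simp: subalgebra_def)
      then show ?thesis unfolding u_def using G by measurable
    qed
    have "AE \<omega> in M. real_cond_exp M ?F u \<omega>
        = real_cond_exp M ?F (indicator G) \<omega> - real_cond_exp M ?F (real_cond_exp M ?F (indicator G)) \<omega>"
      unfolding u_def by (intro F.real_cond_exp_diff intG F.real_cond_exp_int)
    moreover have "AE \<omega> in M. real_cond_exp M ?F (real_cond_exp M ?F (indicator G)) \<omega>
        = real_cond_exp M ?F (indicator G) \<omega>"
      by (intro F.real_cond_exp_F_meas F.real_cond_exp_int intG) simp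
    ultimately have u0: "AE \<omega> in M. real_cond_exp M ?F u \<omega> = 0" by eventually_elim simp
    have "(\<integral>\<omega>. indicator {..\<xi>} (x k \<omega>) * u \<omega> \<partial>M) = 0"
    proof (rule integral_indicator_eq_0_if_cos[OF _ u])
      fix \<theta> t
      \<comment> \<open>The prediction of \<open>t \<bullet> x k\<close> is the combination, with
        weights \<open>t $ l\<close>, of the predictions of the components; \<open>b\<close> below
        holds the coefficients of its residual.\<close>
      define s where "s = (\<lambda>i. \<Sum>l\<in>UNIV. t $ l *\<^sub>R a l i)"
      define b where "b = (\<lambda>i. (if i = k then t else 0) - (if i \<in> J then s i else 0))"
      define S where "S = (\<lambda>\<omega>. \<Sum>i\<in>J. s i \<bullet> x i \<omega>)"
      have S[measurable]: "S \<in> borel_measurable ?F"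
        unfolding S_def by (intro borel_measurable_sum borel_measurable_inner borel_measurable_const
            measurable_generated_by)
      have SM[measurable]: "S \<in> borel_measurable M" using F S by (rule measurable_from_subalg)
      have SF': "S \<in> borel_measurable ?F'"
        using sub S by (intro measurable_from_subalg[of ?F' ?F]) (auto simp: subalgebra_def)
      have b: "lin b \<omega> = t \<bullet> x k \<omega> - S \<omega>" for \<omega>
        unfolding b_def S_def lin_single[OF k] lin_residual[OF J] by simp
      have b_sum: "lin b \<omega> = (\<Sum>l\<in>UNIV. t $ l * (x k \<omega> $ l - (\<Sum>i\<in>J. a l i \<bullet> x i \<omega>)))" for \<omega>
      proof -
        have "S \<omega> = (\<Sum>i\<in>J. \<Sum>l\<in>UNIV. t $ l * (a l i \<bullet> x i \<omega>))"
          by (simp add: S_def s_def inner_sum_left)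
        also have "\<dots> = (\<Sum>l\<in>UNIV. t $ l * (\<Sum>i\<in>J. a l i \<bullet> x i \<omega>))"
          by (subst sum.swap) (simp add: sum_distrib_left)
        finally show ?thesis unfolding b by (simp add: inner_vec_def right_diff_distrib sum_subtractf)
      qed
      have orth: "(\<integral>\<omega>. lin b \<omega> * x i \<omega> $ m \<partial>M) = 0" if i: "i \<in> J'" for i m
      proof -
        have iI: "i \<in> I" using i JJ' by auto
        have "(\<integral>\<omega>. lin b \<omega> * x i \<omega> $ m \<partial>M)
          = (\<integral>\<omega>. (\<Sum>l\<in>UNIV. t $ l * ((x k \<omega> $ l - (\<Sum>i\<in>J. a l i \<bullet> x i \<omega>)) * x i \<omega> $ m)) \<partial>M)"
          by (simp add: b_sum sum_distrib_right mult.assoc)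
        also have "\<dots> = (\<Sum>l\<in>UNIV. t $ l * (\<integral>\<omega>. (x k \<omega> $ l - (\<Sum>i\<in>J. a l i \<bullet> x i \<omega>)) * x i \<omega> $ m \<partial>M))"
          by (subst Bochner_Integration.integral_sum)
            (simp_all add: lin_component[OF k] lin_component[OF iI] lin_residual[OF J] integrable_lin_lin)
        also have "\<dots> = 0" using a[OF i] by simp
        finally show ?thesis .
      qed
      \<comment> \<open>Independence factors the integral, and pulling the F-measurable cosine of
        \<open>S\<close> out of E(u | F) = 0 annihilates the second factor.\<close>
      have zero: "(\<integral>\<omega>. cos (\<phi> + lin b \<omega>) * (cos (\<psi> + S \<omega>) * u \<omega>) \<partial>M) = 0" for \<phi> \<psi>
      proof -
        have int: "integrable M (\<lambda>\<omega>. cos (\<psi> + S \<omega>) * u \<omega>)" by (intro integrable_cos_mult u) measurable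
        have "(\<integral>\<omega>. cos (\<psi> + S \<omega>) * u \<omega> \<partial>M) = 0"
          by (rule F.integral_mult_eq_0_if_cond_exp_eq_0[OF u0 _ _ int]) (use u in \<open>auto intro: S\<close>)
        moreover have "(\<lambda>\<omega>. cos (\<psi> + S \<omega>) * u \<omega>) \<in> borel_measurable ?F'"
          using SF' uF' by measurable
        ultimately show ?thesis
          by (subst integral_mult_cos_orthogonal[OF JJ'(2) orth _ int]) auto
      qed
      \<comment> \<open>The addition theorem cos (A + B) = cos A cos B - sin A sin B with A =
        \<open>lin b \<omega>\<close> and B = \<open>\<theta> + S \<omega>\<close>; both sines are
        written as cosines shifted by -pi/2 so that \<open>zero\<close> covers both terms.\<close>
      have *: "cos (\<theta> + t \<bullet> x k \<omega>) * u \<omega> = cos (0 + lin b \<omega>) * (cos (\<theta> + S \<omega>) * u \<omega>)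
          - cos (- (pi / 2) + lin b \<omega>) * (cos (\<theta> - pi / 2 + S \<omega>) * u \<omega>)" for \<omega>
      proof -
        have sin: "cos (y - pi / 2) = sin y" for y :: real by (simp add: cos_diff)
        have "\<theta> + t \<bullet> x k \<omega> = lin b \<omega> + (\<theta> + S \<omega>)" by (simp add: b)
        moreover have "- (pi / 2) + lin b \<omega> = lin b \<omega> - pi / 2" "\<theta> - pi / 2 + S \<omega> = \<theta> + S \<omega> - pi / 2"
          by simp_all
        ultimately show ?thesis by (simp only: sin cos_add[of "lin b \<omega>"]) (simp add: left_diff_distrib)
      qed
      have int: "integrable M (\<lambda>\<omega>. cos (\<phi> + lin b \<omega>) * (cos (\<psi> + S \<omega>) * u \<omega>))" for \<phi> \<psi>
        by (intro integrable_cos_mult u) measurable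
      show "(\<integral>\<omega>. cos (\<theta> + t \<bullet> x k \<omega>) * u \<omega> \<partial>M) = 0"
        unfolding * Bochner_Integration.integral_diff[OF int int] zero by simp
    qed auto
    moreover have "(\<integral>\<omega>. indicator {..\<xi>} (x k \<omega>) * u \<omega> \<partial>M) = (\<integral>\<omega>. indicator B \<omega> * u \<omega> \<partial>M)"
      by (intro Bochner_Integration.integral_cong) (auto simp: B_eq indicator_def)
    ultimately show "(\<integral>\<omega>. indicator B \<omega> * (indicator G \<omega> - real_cond_exp M ?F (indicator G) \<omega>) \<partial>M) = 0"
      by (simp add: u_def)
  qed
qed

text \<open>Equal conditional CDFs force equal conditional means given \<open>J'\<close> and given
  \<open>J\<close>. The mean given \<open>J\<close> is the linear prediction, so the residual has
  conditional mean 0 given \<open>J'\<close> and is therefore orthogonal to every \<open>x i\<close>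
  with \<open>i \<in> J'\<close>.\<close>

lemma prediction_if_cond_cdf_eq:
  assumes JJ': "J \<subseteq> J'" "J' \<subseteq> I" and k: "k \<in> I"
    and cdf: "\<And>\<xi>. AE \<omega> in M. cond_cdf M x k J' \<xi> \<omega> = cond_cdf M x k J \<xi> \<omega>"
  shows "\<exists>a. \<forall>i\<in>J'. \<forall>m. (\<integral>\<omega>. (x k \<omega> $ l - (\<Sum>i\<in>J. a i \<bullet> x i \<omega>)) * x i \<omega> $ m \<partial>M) = 0"
proof -
  let ?F = "generated_by M J x" and ?F' = "generated_by M J' x"
  have J: "J \<subseteq> I" by (rule order_trans[OF JJ'])
  have F: "subalgebra M ?F" and F': "subalgebra M ?F'"
    using subsetD[OF J] subsetD[OF JJ'(2)]
    by (simp_all add: subalgebra_generated_by measurable_x)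
  interpret F: sigma_finite_subalgebra M ?F using F by (rule sigma_finite_subalgebra_if_subalgebra)
  interpret F': sigma_finite_subalgebra M ?F' using F' by (rule sigma_finite_subalgebra_if_subalgebra)
  have sub: "sets ?F \<subseteq> sets ?F'" by (rule sets_generated_by_mono) fact
  have [measurable]: "x k \<in> borel_measurable M" using k by (rule measurable_x)
  have xkl[measurable]: "(\<lambda>\<omega>. x k \<omega> $ l) \<in> borel_measurable M" and int_xkl: "integrable M (\<lambda>\<omega>. x k \<omega> $ l)"
    using integrable_lin by (simp_all add: lin_component[OF k])
  \<comment> \<open>A prediction with residual orthogonal over \<open>J\<close> always exists; the
    content of the claim is that the same coefficients work over \<open>J'\<close>.\<close>
  have "\<exists>a. \<forall>i\<in>J. \<forall>m. (\<integral>\<omega>. (x k \<omega> $ l - (\<Sum>i\<in>J. a i \<bullet> x i \<omega>)) * x i \<omega> $ m \<partial>M) = 0"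
    unfolding lin_component[OF k] by (rule ex_linear_prediction[OF J])
  then obtain a where "\<forall>i\<in>J. \<forall>m.
      (\<integral>\<omega>. (x k \<omega> $ l - (\<Sum>i\<in>J. a i \<bullet> x i \<omega>)) * x i \<omega> $ m \<partial>M) = 0" ..
  then have a: "(\<integral>\<omega>. (x k \<omega> $ l - (\<Sum>i\<in>J. a i \<bullet> x i \<omega>)) * x i \<omega> $ m \<partial>M) = 0"
    if "i \<in> J" for i m using that by blast
  define b where "b = (\<lambda>i. (if i = k then axis l 1 else 0) - (if i \<in> J then a i else 0))"
  have b: "x k \<omega> $ l - (\<Sum>i\<in>J. a i \<bullet> x i \<omega>) = lin b \<omega>" for \<omega>
    unfolding b_def lin_component[OF k] lin_residual[OF J] ..
  define S where "S = (\<lambda>\<omega>. \<Sum>i\<in>J. a i \<bullet> x i \<omega>)"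
  have S: "S \<in> borel_measurable ?F"
    unfolding S_def by (intro borel_measurable_sum borel_measurable_inner borel_measurable_const
        measurable_generated_by)
  have int_S: "integrable M S"
    unfolding S_def lin_restrict[OF J] by (rule integrable_lin)
  have SF': "S \<in> borel_measurable ?F'"
    using sub S by (intro measurable_from_subalg[of ?F' ?F]) (auto simp: subalgebra_def)
  have eq: "AE \<omega> in M. real_cond_exp M ?F' (\<lambda>\<omega>. x k \<omega> $ l) \<omega> = real_cond_exp M ?F (\<lambda>\<omega>. x k \<omega> $ l) \<omega>"
    unfolding real_cond_exp_eq_iff_innovation[OF F F' sub int_xkl]
  proof
    fix G assume G: "G \<in> sets ?F'"
    then have GM: "G \<in> sets M" using F' by (auto simp: subalgebra_def)
    then have intG: "integrable M (indicator G :: 'a \<Rightarrow> real)"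
      by (simp add: emeasure_eq_measure integrable_indicator_iff)
    define u where "u = (\<lambda>\<omega>. indicator G \<omega> - real_cond_exp M ?F (indicator G) \<omega>)"
    have u: "integrable M u" unfolding u_def
      by (intro Bochner_Integration.integrable_diff intG F.real_cond_exp_int)
    \<comment> \<open>By duality the CDF hypothesis is this claim for lower orthants. The innovation
      \<open>u\<close> has integral 0, as a conditional probability has the mean of its event, so
      the claim extends to all Borel sets.\<close>
    have ind: "(\<integral>\<omega>. indicator A (x k \<omega>) * u \<omega> \<partial>M) = 0" if "A \<in> sets borel" for A
    proof (rule integral_indicator_generator_eq_0[OF _ u])
      show "(\<integral>\<omega>. u \<omega> \<partial>M) = 0"
        unfolding u_def using intG F.real_cond_exp_int[OF intG] by simp
      show "Int_stable (range (\<lambda>a :: real ^ 'd. {..a}))" by (rule Int_stable_atMost_vec)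
      show "sets borel = sigma_sets (space borel) (range (\<lambda>a :: real ^ 'd. {..a}))"
        by (subst borel_eq_atMost) simp
      fix C assume "C \<in> range (\<lambda>a :: real ^ 'd. {..a})"
      then obtain \<xi> where C: "C = {..\<xi>}" by auto
      define B where "B = {\<omega> \<in> space M. \<forall>i. x k \<omega> $ i \<le> \<xi> $ i}"
      have B_eq: "B = x k -` C \<inter> space M" by (auto simp: B_def C less_eq_vec_def)
      have "B \<in> sets M" unfolding B_eq C by measurable
      then have intB: "integrable M (indicator B :: 'a \<Rightarrow> real)"
        by (simp add: emeasure_eq_measure integrable_indicator_iff)
      have "(\<integral>\<omega>. indicator B \<omega> * u \<omega> \<partial>M) = 0"
        using cdf[of \<xi>] G
        unfolding cond_cdf_def B_def[symmetric] real_cond_exp_eq_iff_innovation[OF F F' sub intB] u_def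
        by blast
      moreover have "(\<integral>\<omega>. indicator C (x k \<omega>) * u \<omega> \<partial>M) = (\<integral>\<omega>. indicator B \<omega> * u \<omega> \<partial>M)"
        by (intro Bochner_Integration.integral_cong) (auto simp: B_eq indicator_def)
      ultimately show "(\<integral>\<omega>. indicator C (x k \<omega>) * u \<omega> \<partial>M) = 0" by simp
    qed (use that in auto)
    have "(\<integral>\<omega>. x k \<omega> $ l * u \<omega> \<partial>M) = 0"
    proof (rule integral_mult_eq_0_if_indicator[OF xkl u])
      show "integrable M (\<lambda>\<omega>. x k \<omega> $ l * u \<omega>)"
        using integrable_indicator_mult_set[OF GM int_xkl]
          integrable_mult_real_cond_exp_indicator[OF F GM int_xkl]
        by (auto simp: u_def right_diff_distrib)
      fix A :: "real set" assume A: "A \<in> sets borel"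
      have "(\<lambda>v :: real ^ 'd. v $ l) \<in> borel_measurable borel"
        by (intro borel_measurable_continuous_onI continuous_intros)
      from measurable_sets[OF this A] have "{v :: real ^ 'd. v $ l \<in> A} \<in> sets borel"
        by (simp add: vimage_def)
      from ind[OF this] show "(\<integral>\<omega>. indicator A (x k \<omega> $ l) * u \<omega> \<partial>M) = 0"
        by (simp add: indicator_def)
    qed
    then show "(\<integral>\<omega>. x k \<omega> $ l * (indicator G \<omega> - real_cond_exp M ?F (indicator G) \<omega>) \<partial>M) = 0"
      by (simp add: u_def)
  qed
  have split: "x k \<omega> $ l = lin b \<omega> + S \<omega>" for \<omega> using b[of \<omega>] by (simp add: S_def)
  have orthJ: "(\<integral>\<omega>. lin b \<omega> * x i \<omega> $ m \<partial>M) = 0" if "i \<in> J" for i m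
    using a[OF that] by (simp add: b)
  have "AE \<omega> in M. real_cond_exp M ?F (\<lambda>\<omega>. x k \<omega> $ l) \<omega>
      = real_cond_exp M ?F (lin b) \<omega> + real_cond_exp M ?F S \<omega>"
    unfolding split by (rule F.real_cond_exp_add[OF integrable_lin int_S])
  moreover have "AE \<omega> in M. real_cond_exp M ?F (lin b) \<omega> = 0"
    by (rule cond_exp_orthogonal[OF J orthJ])
  moreover have "AE \<omega> in M. real_cond_exp M ?F S \<omega> = S \<omega>"
    by (rule F.real_cond_exp_F_meas[OF int_S S])
  moreover have "AE \<omega> in M. real_cond_exp M ?F' (\<lambda>\<omega>. x k \<omega> $ l) \<omega>
      = real_cond_exp M ?F' (lin b) \<omega> + real_cond_exp M ?F' S \<omega>"
    unfolding split by (rule F'.real_cond_exp_add[OF integrable_lin int_S])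
  moreover have "AE \<omega> in M. real_cond_exp M ?F' S \<omega> = S \<omega>"
    by (rule F'.real_cond_exp_F_meas[OF int_S SF'])
  \<comment> \<open>Since \<open>S\<close> is measurable for both sigma-algebras, it cancels: E(lin
    b | F') = E(x_k,l | F') - S = E(x_k,l | F) - S = E(lin b | F) = 0.\<close>
  ultimately have zero: "AE \<omega> in M. real_cond_exp M ?F' (lin b) \<omega> = 0"
    using eq by eventually_elim simp
  have "(\<integral>\<omega>. lin b \<omega> * x i \<omega> $ m \<partial>M) = 0" if i: "i \<in> J'" for i m
  proof -
    have iI: "i \<in> I" using i JJ' by auto
    have "(\<lambda>v :: real ^ 'd. v $ m) \<in> borel_measurable borel"
      by (intro borel_measurable_continuous_onI continuous_intros)
    from measurable_compose[OF measurable_generated_by[OF i] this]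
    have "(\<lambda>\<omega>. x i \<omega> $ m) \<in> borel_measurable ?F'" .
    moreover have "integrable M (\<lambda>\<omega>. x i \<omega> $ m * lin b \<omega>)"
      unfolding lin_component[OF iI] by (rule integrable_lin_lin)
    ultimately have "(\<integral>\<omega>. x i \<omega> $ m * lin b \<omega> \<partial>M) = 0"
      by (intro F'.integral_mult_eq_0_if_cond_exp_eq_0[OF zero]) simp_all
    then show ?thesis by (simp add: mult.commute)
  qed
  then show ?thesis unfolding b[symmetric] by blast
qed

end

section \<open>Conditionally Markov sequences\<close>

lemma (in prob_space) uncorrelated_iff_zero_mean:
  fixes X :: "'a \<Rightarrow> real ^ 'm" and Y :: "'a \<Rightarrow> real ^ 'n"
  assumes "\<And>i. (\<integral>\<omega>. X \<omega> $ i \<partial>M) = 0" "\<And>j. (\<integral>\<omega>. Y \<omega> $ j \<partial>M) = 0"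
  shows "uncorrelated M X Y \<longleftrightarrow> (\<forall>i j. (\<integral>\<omega>. X \<omega> $ i * Y \<omega> $ j \<partial>M) = 0)"
  by (simp add: uncorrelated_def cross_cov_def assms vec_eq_iff)

lemma gaussian_seq_subset:
  assumes "gaussian_seq M I x" "J \<subseteq> I" "finite I"
  shows "gaussian_seq M J x"
  unfolding gaussian_seq_def
proof (intro conjI ballI allI)
  show "k \<in> J \<Longrightarrow> x k \<in> borel_measurable M" for k
    using assms by (auto simp: gaussian_seq_def)
  fix a
  have "(\<Sum>k\<in>J. a k \<bullet> x k \<omega>) = (\<Sum>k\<in>I. (if k \<in> J then a k else 0) \<bullet> x k \<omega>)" for \<omega>
    using assms by (intro sum.mono_neutral_cong_left) auto
  then show "normal_rv M (\<lambda>\<omega>. \<Sum>k\<in>J. a k \<bullet> x k \<omega>)"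
    using assms(1) by (simp add: gaussian_seq_def)
qed

section \<open>Removing and restoring the multiple of the conditioning vector\<close>

context gaussian_family
begin

lemma cond_cdf_eq_iff_prediction:
  assumes "J \<subseteq> J'" "J' \<subseteq> I" "k \<in> I"
  shows "(\<forall>\<xi>. AE \<omega> in M. cond_cdf M x k J' \<xi> \<omega> = cond_cdf M x k J \<xi> \<omega>) \<longleftrightarrow>
    (\<forall>l. \<exists>a. \<forall>i\<in>J'. \<forall>m. (\<integral>\<omega>. (x k \<omega> $ l - (\<Sum>i\<in>J. a i \<bullet> x i \<omega>)) * x i \<omega> $ m \<partial>M) = 0)"
proof
  assume "\<forall>\<xi>. AE \<omega> in M. cond_cdf M x k J' \<xi> \<omega> = cond_cdf M x k J \<xi> \<omega>"
  then show "\<forall>l. \<exists>a. \<forall>i\<in>J'. \<forall>m.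
      (\<integral>\<omega>. (x k \<omega> $ l - (\<Sum>i\<in>J. a i \<bullet> x i \<omega>)) * x i \<omega> $ m \<partial>M) = 0"
    by (intro allI prediction_if_cond_cdf_eq[OF assms]) (rule spec)
next
  assume "\<forall>l. \<exists>a. \<forall>i\<in>J'. \<forall>m.
      (\<integral>\<omega>. (x k \<omega> $ l - (\<Sum>i\<in>J. a i \<bullet> x i \<omega>)) * x i \<omega> $ m \<partial>M) = 0"
  then show "\<forall>\<xi>. AE \<omega> in M. cond_cdf M x k J' \<xi> \<omega> = cond_cdf M x k J \<xi> \<omega>"
    by (intro allI cond_cdf_eq_if_prediction[OF assms]) (rule spec)
qed

text \<open>Subtracting multiples of \<open>x c\<close>, to which the residuals of \<open>y\<close> are orthogonal anyway, turns
  a prediction of \<open>x k\<close> from \<open>x j, x c\<close> into one of \<open>y k\<close> from \<open>y j\<close>, and back.\<close>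

lemma CM_seq_iff_markov_seq:
  fixes y :: "nat \<Rightarrow> 'a \<Rightarrow> real ^ 'd" and \<Gamma> :: "nat \<Rightarrow> real ^ 'd ^ 'd"
  assumes I: "I = {0..N}" and c: "c \<in> {0, N}"
    and y: "gaussian_family M (I - {c}) y"
    and rel: "\<And>k. k \<in> I - {c} \<Longrightarrow> AE \<omega> in M. x k \<omega> = y k \<omega> + \<Gamma> k *v x c \<omega>"
    and uncorr: "\<And>k m n. k \<in> I - {c} \<Longrightarrow> (\<integral>\<omega>. x c \<omega> $ m * y k \<omega> $ n \<partial>M) = 0"
  shows "CM_seq M N c x \<longleftrightarrow> markov_seq M (I - {c}) y"
proof -
  interpret Y: gaussian_family M "I - {c}" y by fact
  have cI: "c \<in> I" using I c by auto
  note L2 = square_integrable_component square_integrable_inner Y.square_integrable_component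
    Y.square_integrable_inner square_integrable_add square_integrable_diff
  note measurable_times = borel_measurable_times[OF square_integrable_measurable square_integrable_measurable]
  have orth: "(\<integral>\<omega>. y k \<omega> $ n * (t \<bullet> x c \<omega>) \<partial>M) = 0" if "k \<in> I - {c}" for k n t
    using integral_inner_mult_eq_0[OF square_integrable_component[OF cI]
        Y.square_integrable_component[OF that] uncorr[OF that]]
    by (simp add: mult.commute)
  have orth': "(\<integral>\<omega>. (s \<bullet> y k \<omega>) * (t \<bullet> x c \<omega>) \<partial>M) = 0" if "k \<in> I - {c}" for k s t
    by (rule integral_inner_mult_eq_0[OF Y.square_integrable_component[OF that]
          square_integrable_inner[OF cI] orth[OF that]])
  have rel_comp: "AE \<omega> in M. x k \<omega> $ l = y k \<omega> $ l + \<Gamma> k $ l \<bullet> x c \<omega>" if "k \<in> I - {c}" for k l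
    using rel[OF that] by eventually_elim (simp add: matrix_vector_mul_component)
  have rel_inner: "AE \<omega> in M. s \<bullet> x k \<omega> = s \<bullet> y k \<omega> + (s v* \<Gamma> k) \<bullet> x c \<omega>" if "k \<in> I - {c}" for k s
    using rel[OF that] by eventually_elim (simp add: inner_add_right dot_lmul_matrix)
  \<comment> \<open>Pairs in which neither index is \<open>c\<close>. For them the index sets on the
    left are those on the right with \<open>c\<close> adjoined, which makes residuals for
    \<open>x\<close> and for \<open>y\<close> comparable.\<close>
  have key: "(\<forall>\<xi>. AE \<omega> in M. cond_cdf M x k ({0..j} \<union> {c}) \<xi> \<omega> = cond_cdf M x k {j, c} \<xi> \<omega>) \<longleftrightarrow>
      (\<forall>\<xi>. AE \<omega> in M. cond_cdf M y k {i \<in> I - {c}. i \<le> j} \<xi> \<omega> = cond_cdf M y k {j} \<xi> \<omega>)"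
    if j: "j \<in> I - {c}" and k: "k \<in> I - {c}" and jk: "j < k" for j k
  proof -
    have jc: "j \<noteq> c" using j by auto
    have K: "{j, c} \<subseteq> {0..j} \<union> {c}" "{0..j} \<union> {c} \<subseteq> I" "k \<in> I"
      "{j} \<subseteq> {i \<in> I - {c}. i \<le> j}" "{i \<in> I - {c}. i \<le> j} \<subseteq> I - {c}"
      using j k jk I cI by auto
    define R where "R = (\<lambda>l \<alpha> \<omega>. y k \<omega> $ l - \<alpha> \<bullet> y j \<omega>)"
    define r where "r = (\<lambda>l \<alpha> \<beta> \<omega>. x k \<omega> $ l - (\<alpha> \<bullet> x j \<omega> + \<beta> \<bullet> x c \<omega>))"
    have R_L2: "R l \<alpha> \<in> square_integrable M" for l \<alpha>
      unfolding R_def using j k by (intro L2)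
    have r_L2: "r l \<alpha> \<beta> \<in> square_integrable M" for l \<alpha> \<beta>
      unfolding r_def using j k cI by (intro L2) auto
    have R_c: "(\<integral>\<omega>. R l \<alpha> \<omega> * (t \<bullet> x c \<omega>) \<partial>M) = 0" for l \<alpha> t
      unfolding R_def using j k cI
      by (subst integral_diff_mult) (auto intro!: L2 simp: orth orth')
    \<comment> \<open>Substituting the representation of \<open>x k\<close> and \<open>x j\<close>,
      the two residuals differ only by a multiple of \<open>x c\<close>; the free coefficient
      \<beta> can cancel it.\<close>
    have r_R: "AE \<omega> in M. r l \<alpha> \<beta> \<omega> = R l \<alpha> \<omega> + (\<Gamma> k $ l - \<alpha> v* \<Gamma> j - \<beta>) \<bullet> x c \<omega>" for l \<alpha> \<beta>
      using rel_comp[OF k, of l] rel_inner[OF j, of \<alpha>]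
      by eventually_elim (simp add: r_def R_def inner_diff_left)
    have "(\<exists>a. \<forall>i\<in>{0..j} \<union> {c}. \<forall>m. (\<integral>\<omega>. r l (a j) (a c) \<omega> * x i \<omega> $ m \<partial>M) = 0) \<longleftrightarrow>
      (\<exists>a. \<forall>i\<in>{i \<in> I - {c}. i \<le> j}. \<forall>m. (\<integral>\<omega>. R l (a j) \<omega> * y i \<omega> $ m \<partial>M) = 0)" (is "?L \<longleftrightarrow> ?R") for l
    proof
      assume ?L
      then obtain a where a: "\<And>i m. i \<in> {0..j} \<union> {c} \<Longrightarrow> (\<integral>\<omega>. r l (a j) (a c) \<omega> * x i \<omega> $ m \<partial>M) = 0"
        by blast
      have r_c: "(\<integral>\<omega>. r l (a j) (a c) \<omega> * (t \<bullet> x c \<omega>) \<partial>M) = 0" for t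
        using integral_inner_mult_eq_0[OF square_integrable_component[OF cI] r_L2, of l "a j" "a c" t] a[of c]
        by (simp add: mult.commute)
      let ?\<delta> = "\<Gamma> k $ l - a j v* \<Gamma> j - a c"
      have "(\<integral>\<omega>. R l (a j) \<omega> * y i \<omega> $ m \<partial>M) = 0" if i: "i \<in> I - {c}" "i \<le> j" for i m
      proof -
        \<comment> \<open>A multiple of \<open>x c\<close> may be added to \<open>R\<close> because
          \<open>y i\<close> is orthogonal to \<open>x c\<close>; this turns \<open>R\<close> into
          \<open>r\<close>, which is orthogonal to both parts of y_i = x_i - \<Gamma>_i x_c.\<close>
        have "(\<integral>\<omega>. R l (a j) \<omega> * y i \<omega> $ m \<partial>M)
            = (\<integral>\<omega>. (R l (a j) \<omega> + ?\<delta> \<bullet> x c \<omega>) * y i \<omega> $ m \<partial>M)"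
          using orth[OF i(1), of m ?\<delta>]
          by (subst integral_add_mult) (auto intro!: R_L2 L2 i cI simp: mult.commute)
        also have "\<dots> = (\<integral>\<omega>. (x i \<omega> $ m - \<Gamma> i $ m \<bullet> x c \<omega>) * r l (a j) (a c) \<omega> \<partial>M)"
        proof (rule integral_cong_AE)
          show "AE \<omega> in M. (R l (a j) \<omega> + ?\<delta> \<bullet> x c \<omega>) * y i \<omega> $ m
              = (x i \<omega> $ m - \<Gamma> i $ m \<bullet> x c \<omega>) * r l (a j) (a c) \<omega>"
            using r_R[of l "a j" "a c"] rel_comp[OF i(1), of m] by eventually_elim simp
        qed (use i cI in \<open>auto intro!: measurable_times L2 R_L2 r_L2\<close>)
        also have "\<dots> = 0"
          using i cI a[of i m] r_c[of "\<Gamma> i $ m"]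
          by (subst integral_diff_mult) (auto intro!: L2 r_L2 simp: mult.commute)
        finally show ?thesis .
      qed
      then show ?R by (intro exI[of _ a]) blast
    next
      assume ?R
      then obtain a where a: "\<And>i m. i \<in> I - {c} \<Longrightarrow> i \<le> j \<Longrightarrow> (\<integral>\<omega>. R l (a j) \<omega> * y i \<omega> $ m \<partial>M) = 0"
        by blast
      \<comment> \<open>The coefficient of \<open>x c\<close> is chosen to cancel the difference in
        \<open>r_R\<close>, so that \<open>r\<close> equals \<open>R\<close> almost surely. Since
        \<open>j\<close> differs from \<open>c\<close>, the coefficient at \<open>j\<close> is
        unchanged.\<close>
      define b where "b = a(c := \<Gamma> k $ l - a j v* \<Gamma> j)"
      have r_R': "AE \<omega> in M. r l (b j) (b c) \<omega> = R l (a j) \<omega>"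
        using r_R[of l "b j" "b c"] by eventually_elim (simp add: b_def jc)
      have "(\<integral>\<omega>. r l (b j) (b c) \<omega> * x i \<omega> $ m \<partial>M) = 0" if "i \<in> {0..j} \<union> {c}" for i m
      proof (cases "i = c")
        case True
        have "(\<integral>\<omega>. r l (b j) (b c) \<omega> * x i \<omega> $ m \<partial>M) = (\<integral>\<omega>. R l (a j) \<omega> * (axis m 1 \<bullet> x c \<omega>) \<partial>M)"
        proof (rule integral_cong_AE)
          show "AE \<omega> in M. r l (b j) (b c) \<omega> * x i \<omega> $ m = R l (a j) \<omega> * (axis m 1 \<bullet> x c \<omega>)"
            using r_R' by eventually_elim (simp add: True cart_eq_inner_axis inner_commute)
        qed (use True cI in \<open>auto intro!: measurable_times L2 R_L2 r_L2\<close>)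
        then show ?thesis by (simp add: R_c)
      next
        case False
        then have i: "i \<in> I - {c}" "i \<le> j" using that j I by auto
        have "(\<integral>\<omega>. r l (b j) (b c) \<omega> * x i \<omega> $ m \<partial>M)
            = (\<integral>\<omega>. (y i \<omega> $ m + \<Gamma> i $ m \<bullet> x c \<omega>) * R l (a j) \<omega> \<partial>M)"
        proof (rule integral_cong_AE)
          show "AE \<omega> in M. r l (b j) (b c) \<omega> * x i \<omega> $ m = (y i \<omega> $ m + \<Gamma> i $ m \<bullet> x c \<omega>) * R l (a j) \<omega>"
            using r_R' rel_comp[OF i(1), of m] by eventually_elim simp
        qed (use i cI in \<open>auto intro!: measurable_times L2 R_L2 r_L2\<close>)
        also have "\<dots> = 0"
          using i cI a[OF i, of m] R_c[of l "a j" "\<Gamma> i $ m"]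
          by (subst integral_add_mult) (auto intro!: L2 R_L2 simp: mult.commute)
        finally show ?thesis .
      qed
      then show ?L by (intro exI[of _ b]) blast
    qed
    then show ?thesis
      unfolding cond_cdf_eq_iff_prediction[OF K(1-3)] Y.cond_cdf_eq_iff_prediction[OF K(4,5) k]
      by (simp add: r_def R_def jc)
  qed
  \<comment> \<open>The position of \<open>c\<close> at an end of the interval enters here: for c =
    0 both conditioning sets are {0}, and for c = N no \<open>k\<close> in \<open>I\<close> exceeds
    \<open>j\<close>.\<close>
  have trivial_j: "cond_cdf M x k ({0..j} \<union> {c}) \<xi> \<omega> = cond_cdf M x k {j, c} \<xi> \<omega>"
    if "j = c" "j \<in> I" "k \<in> I" "j < k" for j k \<xi> \<omega>
    using that c I by auto
  have trivial_k: "\<forall>\<xi>. AE \<omega> in M. cond_cdf M x c ({0..j} \<union> {c}) \<xi> \<omega> = cond_cdf M x c {j, c} \<xi> \<omega>"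
    if "j \<in> I" "j < c" for j
  proof -
    have K: "{j, c} \<subseteq> {0..j} \<union> {c}" "{0..j} \<union> {c} \<subseteq> I" using that I cI by auto
    have "\<exists>a. \<forall>i\<in>{0..j} \<union> {c}. \<forall>m. (\<integral>\<omega>. (x c \<omega> $ l - (\<Sum>i\<in>{j, c}. a i \<bullet> x i \<omega>)) * x i \<omega> $ m \<partial>M) = 0" for l
      using that
      \<comment> \<open>The vector \<open>x c\<close> belongs to its own conditioning family and
        predicts itself: coefficient \<open>axis l 1\<close> at \<open>c\<close> and 0 at
        \<open>j\<close> leave the residual identically 0.\<close>
      by (intro exI[of _ "\<lambda>i. if i = c then axis l 1 else 0"])
        (simp add: cart_eq_inner_axis inner_commute)
    then show ?thesis unfolding cond_cdf_eq_iff_prediction[OF K cI] by blast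
  qed
  have "CM_seq M N c x \<longleftrightarrow> (\<forall>j\<in>I - {c}. \<forall>k\<in>I - {c}. j < k \<longrightarrow>
      (\<forall>\<xi>. AE \<omega> in M. cond_cdf M x k ({0..j} \<union> {c}) \<xi> \<omega> = cond_cdf M x k {j, c} \<xi> \<omega>))"
    unfolding CM_seq_def I[symmetric]
  proof (intro iffI ballI impI)
    fix j k
    assume *: "\<forall>j\<in>I - {c}. \<forall>k\<in>I - {c}. j < k \<longrightarrow>
      (\<forall>\<xi>. AE \<omega> in M. cond_cdf M x k ({0..j} \<union> {c}) \<xi> \<omega> = cond_cdf M x k {j, c} \<xi> \<omega>)"
      and jk: "j \<in> I" "k \<in> I" "j < k"
    consider "j = c" | "k = c" | "j \<in> I - {c}" "k \<in> I - {c}" using jk by blast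
    then show "\<forall>\<xi>. AE \<omega> in M. cond_cdf M x k ({0..j} \<union> {c}) \<xi> \<omega> = cond_cdf M x k {j, c} \<xi> \<omega>"
    proof cases
      case 1
      then show ?thesis using trivial_j[OF 1 jk] by (intro allI AE_I2)
    next
      case 2
      then show ?thesis using trivial_k[of j] jk by blast
    next
      case 3
      then show ?thesis using * jk(3) by blast
    qed
  qed blast
  also have "\<dots> \<longleftrightarrow> markov_seq M (I - {c}) y"
    unfolding markov_seq_def using key by blast
  finally show ?thesis .
qed

text \<open>Row \<open>l\<close> of \<open>\<Gamma> k\<close> holds the coefficients of a linear
  prediction of component \<open>l\<close> of \<open>x k\<close> from \<open>x c\<close>, and
  \<open>y k\<close> is the residual. For invertible Cov(x_c) this is Cov(x_k, x_c) Cov(x_c)^-1;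
  Gram-Schmidt supplies a choice in the singular case too. The representation holds at every
  \<omega>.\<close>

lemma ex_uncorrelated_residual:
  assumes cI: "c \<in> I"
  shows "\<exists>(y :: nat \<Rightarrow> 'a \<Rightarrow> real ^ 'd) (\<Gamma> :: nat \<Rightarrow> real ^ 'd ^ 'd).
    gaussian_seq M (I - {c}) y \<and> zero_mean_seq M (I - {c}) y \<and>
    (\<forall>k\<in>I - {c}. \<forall>m n. (\<integral>\<omega>. x c \<omega> $ m * y k \<omega> $ n \<partial>M) = 0) \<and>
    (\<forall>k\<in>I - {c}. \<forall>\<omega>. x k \<omega> = y k \<omega> + \<Gamma> k *v x c \<omega>)"
proof -
  have "\<exists>A. k \<in> I \<longrightarrow> (\<forall>m. (\<integral>\<omega>. (x k \<omega> $ l - A \<bullet> x c \<omega>) * x c \<omega> $ m \<partial>M) = 0)" for k l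
  proof (cases "k \<in> I")
    case True
    have "\<exists>a. \<forall>i\<in>{c}. \<forall>m. (\<integral>\<omega>. (x k \<omega> $ l - (\<Sum>i\<in>{c}. a i \<bullet> x i \<omega>)) * x i \<omega> $ m \<partial>M) = 0"
      unfolding lin_component[OF True] using cI by (intro ex_linear_prediction) simp
    then show ?thesis by auto
  qed simp
  then obtain A where A: "\<And>k l m. k \<in> I \<Longrightarrow>
      (\<integral>\<omega>. (x k \<omega> $ l - A k l \<bullet> x c \<omega>) * x c \<omega> $ m \<partial>M) = 0" by metis
  define \<Gamma> :: "nat \<Rightarrow> real ^ 'd ^ 'd" where "\<Gamma> = (\<lambda>k. \<chi> l. A k l)"
  define y where "y = (\<lambda>k \<omega>. x k \<omega> - \<Gamma> k *v x c \<omega>)"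
  have int_x: "integrable M (x k)" "integral\<^sup>L M (x k) = 0" if "k \<in> I" for k
    using zero_mean that by (auto simp: zero_mean_seq_def)
  note bl = matrix_vector_mul_bounded_linear
  have "zero_mean_seq M (I - {c}) y"
    unfolding zero_mean_seq_def y_def using int_x cI
    by (simp add: integrable_bounded_linear[OF bl] integral_bounded_linear[OF bl])
  moreover have "gaussian_seq M (I - {c}) y"
    unfolding gaussian_seq_def
  proof (intro conjI ballI allI)
    fix k assume "k \<in> I - {c}"
    then show "y k \<in> borel_measurable M"
      unfolding y_def using int_x cI
      by (intro borel_measurable_diff borel_measurable_integrable integrable_bounded_linear[OF bl]) auto
  next
    fix a
    \<comment> \<open>A combination of the \<open>y k\<close> is a combination of the
      \<open>x k\<close>: all the terms subtracted are multiples of \<open>x c\<close> and are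
      collected in the coefficient at \<open>c\<close>.\<close>
    define b where "b = a(c := - (\<Sum>k\<in>I - {c}. a k v* \<Gamma> k))"
    have "(\<Sum>k\<in>I - {c}. a k \<bullet> y k \<omega>) = lin b \<omega>" for \<omega>
    proof -
      have "lin b \<omega> = b c \<bullet> x c \<omega> + (\<Sum>k\<in>I - {c}. b k \<bullet> x k \<omega>)"
        unfolding lin_def by (rule sum.remove[OF finite_I cI])
      also have "(\<Sum>k\<in>I - {c}. b k \<bullet> x k \<omega>) = (\<Sum>k\<in>I - {c}. a k \<bullet> x k \<omega>)"
        by (intro sum.cong) (auto simp: b_def)
      also have "b c \<bullet> x c \<omega> = - (\<Sum>k\<in>I - {c}. a k \<bullet> (\<Gamma> k *v x c \<omega>))"
        by (simp add: b_def inner_sum_left dot_lmul_matrix)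
      finally show ?thesis by (simp add: y_def inner_diff_right sum_subtractf)
    qed
    then show "normal_rv M (\<lambda>\<omega>. \<Sum>k\<in>I - {c}. a k \<bullet> y k \<omega>)" using normal_lin by presburger
  qed
  moreover have "(\<integral>\<omega>. x c \<omega> $ m * y k \<omega> $ n \<partial>M) = 0" if "k \<in> I - {c}" for k m n
    using A[of k n m] that by (simp add: y_def \<Gamma>_def matrix_vector_mul_component mult.commute)
  moreover have "x k \<omega> = y k \<omega> + \<Gamma> k *v x c \<omega>" for k \<omega> by (simp add: y_def)
  ultimately show ?thesis by blast
qed

end

theorem proposition5p3:
  fixes M :: "'a measure"
    and N c :: nat
    and x :: "nat \<Rightarrow> 'a \<Rightarrow> real ^ 'd"
  assumes "prob_space M"
    and "c \<in> {0, N}"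
    and "gaussian_seq M {0..N} x"
    and "zero_mean_seq M {0..N} x"
  shows "CM_seq M N c x \<longleftrightarrow>
    (\<exists>(y :: nat \<Rightarrow> 'a \<Rightarrow> real ^ 'd) (\<Gamma> :: nat \<Rightarrow> real ^ 'd ^ 'd).
       gaussian_seq M ({0..N} - {c}) y \<and>
       zero_mean_seq M ({0..N} - {c}) y \<and>
       markov_seq M ({0..N} - {c}) y \<and>
       gaussian_seq M {c} x \<and>
       zero_mean_seq M {c} x \<and>
       (\<forall>k\<in>{0..N} - {c}. uncorrelated M (x c) (y k)) \<and>
       (\<forall>k\<in>{0..N} - {c}. AE \<omega> in M. x k \<omega> = y k \<omega> + \<Gamma> k *v x c \<omega>))"
proof -
  let ?I = "{0..N}"
  interpret prob_space M by fact
  interpret X: gaussian_family M ?I x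
    by unfold_locales (use assms in auto)
  have cI: "c \<in> ?I" using assms(2) by auto
  have Y: "gaussian_family M (?I - {c}) y"
    if "gaussian_seq M (?I - {c}) y" "zero_mean_seq M (?I - {c}) y" for y :: "nat \<Rightarrow> 'a \<Rightarrow> real ^ 'd"
    by unfold_locales (use that in auto)
  \<comment> \<open>The centring in \<open>cross_cov\<close> disappears because all means are 0,
    leaving plain product moments.\<close>
  have uncorr: "uncorrelated M (x c) (y k) \<longleftrightarrow> (\<forall>m n. (\<integral>\<omega>. x c \<omega> $ m * y k \<omega> $ n \<partial>M) = 0)"
    if "gaussian_family M (?I - {c}) y" "k \<in> ?I - {c}" for y :: "nat \<Rightarrow> 'a \<Rightarrow> real ^ 'd" and k
  proof -
    interpret Y: gaussian_family M "?I - {c}" y by fact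
    show ?thesis
      by (rule uncorrelated_iff_zero_mean[OF X.integral_component[OF cI] Y.integral_component[OF that(2)]])
  qed
  show ?thesis
  proof
    assume CM: "CM_seq M N c x"
    obtain y :: "nat \<Rightarrow> 'a \<Rightarrow> real ^ 'd" and \<Gamma> :: "nat \<Rightarrow> real ^ 'd ^ 'd"
      where y: "gaussian_seq M (?I - {c}) y" "zero_mean_seq M (?I - {c}) y"
        and zero: "\<And>k m n. k \<in> ?I - {c} \<Longrightarrow> (\<integral>\<omega>. x c \<omega> $ m * y k \<omega> $ n \<partial>M) = 0"
        and rel: "\<And>k \<omega>. k \<in> ?I - {c} \<Longrightarrow> x k \<omega> = y k \<omega> + \<Gamma> k *v x c \<omega>"
      using X.ex_uncorrelated_residual[OF cI] by blast
    have "markov_seq M (?I - {c}) y"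
      using X.CM_seq_iff_markov_seq[OF refl assms(2) Y[OF y] _ zero, of \<Gamma>] CM rel by simp
    moreover have "gaussian_seq M {c} x"
      using cI by (intro gaussian_seq_subset[OF assms(3)]) auto
    moreover have "zero_mean_seq M {c} x"
      using assms(4) cI by (auto simp: zero_mean_seq_def)
    ultimately show "\<exists>(y :: nat \<Rightarrow> 'a \<Rightarrow> real ^ 'd) (\<Gamma> :: nat \<Rightarrow> real ^ 'd ^ 'd).
       gaussian_seq M (?I - {c}) y \<and> zero_mean_seq M (?I - {c}) y \<and> markov_seq M (?I - {c}) y \<and>
       gaussian_seq M {c} x \<and> zero_mean_seq M {c} x \<and>
       (\<forall>k\<in>?I - {c}. uncorrelated M (x c) (y k)) \<and>
       (\<forall>k\<in>?I - {c}. AE \<omega> in M. x k \<omega> = y k \<omega> + \<Gamma> k *v x c \<omega>)"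
      using y zero rel uncorr[OF Y[OF y]] by (intro exI[of _ y] exI[of _ \<Gamma>]) simp
  next
    assume "\<exists>(y :: nat \<Rightarrow> 'a \<Rightarrow> real ^ 'd) (\<Gamma> :: nat \<Rightarrow> real ^ 'd ^ 'd).
       gaussian_seq M (?I - {c}) y \<and> zero_mean_seq M (?I - {c}) y \<and> markov_seq M (?I - {c}) y \<and>
       gaussian_seq M {c} x \<and> zero_mean_seq M {c} x \<and>
       (\<forall>k\<in>?I - {c}. uncorrelated M (x c) (y k)) \<and>
       (\<forall>k\<in>?I - {c}. AE \<omega> in M. x k \<omega> = y k \<omega> + \<Gamma> k *v x c \<omega>)"
    then obtain y :: "nat \<Rightarrow> 'a \<Rightarrow> real ^ 'd" and \<Gamma> :: "nat \<Rightarrow> real ^ 'd ^ 'd"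
      where y: "gaussian_seq M (?I - {c}) y" "zero_mean_seq M (?I - {c}) y"
        and markov: "markov_seq M (?I - {c}) y"
        and unc: "\<And>k. k \<in> ?I - {c} \<Longrightarrow> uncorrelated M (x c) (y k)"
        and rel: "\<And>k. k \<in> ?I - {c} \<Longrightarrow> AE \<omega> in M. x k \<omega> = y k \<omega> + \<Gamma> k *v x c \<omega>"
      by blast
    have "(\<integral>\<omega>. x c \<omega> $ m * y k \<omega> $ n \<partial>M) = 0" if "k \<in> ?I - {c}" for k m n
      using unc[OF that] uncorr[OF Y[OF y] that] by blast
    \<comment> \<open>The given \<open>y\<close> and \<Gamma> need not be the regression constructed
      for the other direction; the equivalence covers every almost sure representation with
      \<open>x c\<close> uncorrelated with \<open>y\<close>.\<close>
    from X.CM_seq_iff_markov_seq[OF refl assms(2) Y[OF y] rel this] markov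
    show "CM_seq M N c x" by blast
  qed
qed

end
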